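(* Let $G$ be a topological group. The following conditions are equivalent: (1) The canonical compactification $i\colon G\to G^{\mathrm{UC}}$ is a right topological semigroup compactification. (2) $(G^{\mathrm{UC}},i(e))$ is a point-universal $G$-system. (3) $G^{\mathrm{UC}}$ is SUC. (4) $\mathrm{SUC}(G)=\mathrm{UC}(G)$.
   Context: A $G$-space is a Tychonoff space with a continuous left action of $G$; a $G$-map is a continuous equivariant map. $\mathrm{UC}(G)$ is the algebra of bounded continuous $f\colon G\to\mathbb{R}$ such that for every $\varepsilon>0$ there is a neighborhood $V$ of $e$ with $\sup_{g}|f(vg)-f(g)|<\varepsilon$ and $\sup_g|f(gv)-f(g)|<\varepsilon$ for all $v\in V$. $G^{\mathrm{UC}}$ is its Gelfand space, a compact $G$-space, and $i\colon G\to G^{\mathrm{UC}}$ sends $g$ to evaluation at $g$ (it is a $G$-map with dense image, $G$ acting on itself by left translations). A $G$-map $\nu\colon G\to S$ with dense image into a compact $G$-space is a right topological semigroup compactification if $S$ is a compact semigroup such that $s\mapsto sp$ is continuous for every $p\in S$ and $\nu$ is a homomorphism of semigroups. A pointed compact $G$-system $(X,x_0)$ with $Gx_0$ dense is point-universal if for every $x\in X$ there is a $G$-map $X\to\mathrm{cl}(Gx)$ sending $x_0$ to $x$. A compact $G$-space $Y$, with its unique compatible uniformity $\mu_Y$, is SUC if for every $y_0\in Y$ and every $\varepsilon\in\mu_Y$ there is a neighborhood $U$ of $e$ such that $(guy_0,gy_0)\in\varepsilon$ for all $g\in G$, $u\in U$. $\mathrm{SUC}(G)$ is the set of bounded continuous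 $f\colon G\to\mathbb{R}$ of the form $f=F\circ\nu$ with $\nu\colon G\to Y$ a $G$-map with dense image into a compact SUC $G$-space $Y$ and $F\colon Y\to\mathbb{R}$ continuous.
   Formalization: In (1) the multiplication must also satisfy g·s = ν(g)s for all g in G, s in S (G acts through ν); without this (1) does not imply (2)–(4), e.g. for the extremely amenable group Homeo₊[0,1]. *)

theory Defs
  imports "HOL-Analysis.Analysis"
begin

text \<open>
  A topological group is a type \<open>'g\<close> of class \<^class>\<open>topological_group_add\<close>. The class
  \<^class>\<open>group_add\<close> is not commutative: \<open>g + h\<close> is the group product, \<open>- g\<close> the inverse and \<open>0\<close>
  the neutral element \<open>e\<close>. The group is not assumed to be Hausdorff.
\<close>

subsection \<open>\<open>G\<close>-spaces and \<open>G\<close>-maps\<close>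

definition G_space :: "'x topology \<Rightarrow> ('g::topological_group_add \<Rightarrow> 'x \<Rightarrow> 'x) \<Rightarrow> bool" where
  "G_space X act \<longleftrightarrow>
     completely_regular_space X \<and> Hausdorff_space X \<and>
     continuous_map (prod_topology euclidean X) X (\<lambda>(g, x). act g x) \<and>
     (\<forall>x\<in>topspace X. act 0 x = x) \<and>
     (\<forall>g h. \<forall>x\<in>topspace X. act (g + h) x = act g (act h x))"

definition compact_G_space :: "'x topology \<Rightarrow> ('g::topological_group_add \<Rightarrow> 'x \<Rightarrow> 'x) \<Rightarrow> bool" where
  "compact_G_space X act \<longleftrightarrow> G_space X act \<and> compact_space X"

definition G_map :: "'x topology \<Rightarrow> ('g::topological_group_add \<Rightarrow> 'x \<Rightarrow> 'x) \<Rightarrow>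
    'y topology \<Rightarrow> ('g \<Rightarrow> 'y \<Rightarrow> 'y) \<Rightarrow> ('x \<Rightarrow> 'y) \<Rightarrow> bool" where
  "G_map X actX Y actY f \<longleftrightarrow>
     continuous_map X Y f \<and> (\<forall>g. \<forall>x\<in>topspace X. f (actX g x) = actY g (f x))"

text \<open>\<open>G\<close> acts on itself by left translations, that is, by \<open>(+)\<close>.\<close>

definition dense_G_map :: "'y topology \<Rightarrow> ('g::topological_group_add \<Rightarrow> 'y \<Rightarrow> 'y) \<Rightarrow> ('g \<Rightarrow> 'y) \<Rightarrow> bool" where
  "dense_G_map Y act \<nu> \<longleftrightarrow>
     G_map euclidean (+) Y act \<nu> \<and> Y closure_of (range \<nu>) = topspace Y"

subsection \<open>The algebra \<open>UC(G)\<close> and its Gelfand space\<close>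

definition UC :: "('g::topological_group_add \<Rightarrow> real) set" where
  "UC = {f. continuous_on UNIV f \<and> bounded (range f) \<and>
     (\<forall>\<epsilon>>0. \<forall>\<^sub>F v in nhds 0.
        (SUP g. \<bar>f (v + g) - f g\<bar>) < \<epsilon> \<and> (SUP g. \<bar>f (g + v) - f g\<bar>) < \<epsilon>)}"

text \<open>
  The Gelfand space of an algebra \<open>A\<close> of real functions: the nonzero multiplicative linear
  functionals \<open>A \<rightarrow> \<real>\<close> (set to \<^const>\<open>undefined\<close> outside \<open>A\<close>) with the topology of pointwise
  convergence on \<open>A\<close>.
\<close>

definition gelfand_space :: "('a \<Rightarrow> real) set \<Rightarrow> (('a \<Rightarrow> real) \<Rightarrow> real) topology" where
  "gelfand_space A = subtopology (product_topology (\<lambda>_. euclideanreal) A)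
     {\<phi>. (\<forall>f\<in>A. \<forall>h\<in>A. \<phi> (\<lambda>x. f x + h x) = \<phi> f + \<phi> h) \<and>
         (\<forall>c. \<forall>f\<in>A. \<phi> (\<lambda>x. c * f x) = c * \<phi> f) \<and>
         (\<forall>f\<in>A. \<forall>h\<in>A. \<phi> (\<lambda>x. f x * h x) = \<phi> f * \<phi> h) \<and>
         (\<exists>f\<in>A. \<phi> f \<noteq> 0)}"

abbreviation GUC :: "(('g::topological_group_add \<Rightarrow> real) \<Rightarrow> real) topology" where
  "GUC \<equiv> gelfand_space UC"

text \<open>The action on \<open>G\<^sup>U\<^sup>C\<close> is the one for which evaluation at \<open>h\<close> is sent by \<open>g\<close> to evaluation
  at \<open>g + h\<close>.\<close>

definition GUC_act :: "'g::topological_group_add \<Rightarrow> (('g \<Rightarrow> real) \<Rightarrow> real) \<Rightarrow> (('g \<Rightarrow> real) \<Rightarrow> real)" where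
  "GUC_act g \<phi> = (\<lambda>f\<in>UC. \<phi> (\<lambda>h. f (g + h)))"

definition GUC_map :: "'g::topological_group_add \<Rightarrow> (('g \<Rightarrow> real) \<Rightarrow> real)" where
  "GUC_map g = (\<lambda>f\<in>UC. f g)"

subsection \<open>Right topological semigroup compactifications and point-universality\<close>

text \<open>
  \<open>m\<close> is the multiplication of \<open>S\<close>. The last clause says that \<open>S\<close> carries its two structures
  compatibly: \<open>G\<close> acts on the semigroup \<open>S\<close> by left multiplication through \<open>\<nu>\<close>. On the image of
  \<open>\<nu>\<close> this is automatic, and on all of \<open>S\<close> it amounts to the usual requirement that the left
  translations by elements of \<open>\<nu>(G)\<close> be continuous. It does not follow from the other clauses: if
  \<open>z\<close> outside of \<open>i(G)\<close> is fixed under the right translations of \<open>G\<^sup>U\<^sup>C\<close> (such a \<open>z\<close> exists for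
  nontrivial extremely amenable Hausdorff \<open>G\<close>, e.g. for the orientation preserving homeomorphisms
  of the unit interval), then \<open>s \<cdot> i(h) = sh\<close> and \<open>s \<cdot> p = z\<close> for \<open>p\<close> outside of \<open>i(G)\<close> define a
  multiplication satisfying them.
\<close>

definition right_top_semigroup_compactification ::
    "'y topology \<Rightarrow> ('g::topological_group_add \<Rightarrow> 'y \<Rightarrow> 'y) \<Rightarrow> ('y \<Rightarrow> 'y \<Rightarrow> 'y) \<Rightarrow> ('g \<Rightarrow> 'y) \<Rightarrow> bool" where
  "right_top_semigroup_compactification S act m \<nu> \<longleftrightarrow>
     compact_G_space S act \<and> dense_G_map S act \<nu> \<and>
     (\<forall>s\<in>topspace S. \<forall>t\<in>topspace S. m s t \<in> topspace S) \<and>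
     (\<forall>s\<in>topspace S. \<forall>t\<in>topspace S. \<forall>p\<in>topspace S. m (m s t) p = m s (m t p)) \<and>
     (\<forall>p\<in>topspace S. continuous_map S S (\<lambda>s. m s p)) \<and>
     (\<forall>g h. \<nu> (g + h) = m (\<nu> g) (\<nu> h)) \<and>
     (\<forall>g. \<forall>s\<in>topspace S. act g s = m (\<nu> g) s)"

definition point_universal :: "'x topology \<Rightarrow> ('g::topological_group_add \<Rightarrow> 'x \<Rightarrow> 'x) \<Rightarrow> 'x \<Rightarrow> bool" where
  "point_universal X act x0 \<longleftrightarrow>
     compact_G_space X act \<and> x0 \<in> topspace X \<and>
     X closure_of (range (\<lambda>g. act g x0)) = topspace X \<and>
     (\<forall>x\<in>topspace X. \<exists>\<phi>.
        G_map X act (subtopology X (X closure_of (range (\<lambda>g. act g x)))) act \<phi> \<and> \<phi> x0 = x)"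

subsection \<open>The uniformity of a compact space\<close>

definition is_uniformity :: "'x set \<Rightarrow> ('x \<times> 'x) set set \<Rightarrow> bool" where
  "is_uniformity X \<U> \<longleftrightarrow>
     \<U> \<noteq> {} \<and> (\<forall>E\<in>\<U>. Id_on X \<subseteq> E \<and> E \<subseteq> X \<times> X) \<and>
     (\<forall>E\<in>\<U>. \<forall>F. E \<subseteq> F \<and> F \<subseteq> X \<times> X \<longrightarrow> F \<in> \<U>) \<and>
     (\<forall>E\<in>\<U>. \<forall>F\<in>\<U>. E \<inter> F \<in> \<U>) \<and>
     (\<forall>E\<in>\<U>. E\<inverse> \<in> \<U>) \<and>
     (\<forall>E\<in>\<U>. \<exists>D\<in>\<U>. D O D \<subseteq> E)"

definition compatible_uniformity :: "'x topology \<Rightarrow> ('x \<times> 'x) set set \<Rightarrow> bool" where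
  "compatible_uniformity X \<U> \<longleftrightarrow>
     is_uniformity (topspace X) \<U> \<and>
     (\<forall>U. openin X U \<longleftrightarrow> U \<subseteq> topspace X \<and> (\<forall>x\<in>U. \<exists>E\<in>\<U>. E `` {x} \<subseteq> U))"

definition the_uniformity :: "'x topology \<Rightarrow> ('x \<times> 'x) set set" where
  "the_uniformity X = (THE \<U>. compatible_uniformity X \<U>)"

lemma compatible_uniformityD:
  assumes "compatible_uniformity X \<U>"
  shows "\<U> \<noteq> {}"
    and "E \<in> \<U> \<Longrightarrow> x \<in> topspace X \<Longrightarrow> (x, x) \<in> E"
    and "E \<in> \<U> \<Longrightarrow> E \<subseteq> topspace X \<times> topspace X"
    and "E \<in> \<U> \<Longrightarrow> E \<subseteq> F \<Longrightarrow> F \<subseteq> topspace X \<times> topspace X \<Longrightarrow> F \<in> \<U>"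
    and "E \<in> \<U> \<Longrightarrow> F \<in> \<U> \<Longrightarrow> E \<inter> F \<in> \<U>"
    and "E \<in> \<U> \<Longrightarrow> E\<inverse> \<in> \<U>"
    and "E \<in> \<U> \<Longrightarrow> \<exists>D\<in>\<U>. D O D \<subseteq> E"
    and "openin X U \<longleftrightarrow> U \<subseteq> topspace X \<and> (\<forall>x\<in>U. \<exists>E\<in>\<U>. E `` {x} \<subseteq> U)"
proof -
  have 1: "\<U> \<noteq> {}" and 2: "\<forall>E\<in>\<U>. Id_on (topspace X) \<subseteq> E \<and> E \<subseteq> topspace X \<times> topspace X"
    and 3: "\<forall>E\<in>\<U>. \<forall>F. E \<subseteq> F \<and> F \<subseteq> topspace X \<times> topspace X \<longrightarrow> F \<in> \<U>"
    and 4: "\<forall>E\<in>\<U>. \<forall>F\<in>\<U>. E \<inter> F \<in> \<U>" and 5: "\<forall>E\<in>\<U>. E\<inverse> \<in> \<U>"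
    and 6: "\<forall>E\<in>\<U>. \<exists>D\<in>\<U>. D O D \<subseteq> E"
    and 7: "\<forall>U. openin X U \<longleftrightarrow> U \<subseteq> topspace X \<and> (\<forall>x\<in>U. \<exists>E\<in>\<U>. E `` {x} \<subseteq> U)"
    using assms unfolding compatible_uniformity_def is_uniformity_def by - (elim conjE, assumption)+
  show "\<U> \<noteq> {}" by (fact 1)
  show "E \<in> \<U> \<Longrightarrow> x \<in> topspace X \<Longrightarrow> (x, x) \<in> E" using 2 by blast
  show "E \<in> \<U> \<Longrightarrow> E \<subseteq> topspace X \<times> topspace X" using 2 by blast
  show "E \<in> \<U> \<Longrightarrow> E \<subseteq> F \<Longrightarrow> F \<subseteq> topspace X \<times> topspace X \<Longrightarrow> F \<in> \<U>"
    using 3 by blast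
  show "E \<in> \<U> \<Longrightarrow> F \<in> \<U> \<Longrightarrow> E \<inter> F \<in> \<U>" using 4 by blast
  show "E \<in> \<U> \<Longrightarrow> E\<inverse> \<in> \<U>" using 5 by blast
  show "E \<in> \<U> \<Longrightarrow> \<exists>D\<in>\<U>. D O D \<subseteq> E" using 6 by blast
  show "openin X U \<longleftrightarrow> U \<subseteq> topspace X \<and> (\<forall>x\<in>U. \<exists>E\<in>\<U>. E `` {x} \<subseteq> U)"
    using 7 by (rule spec)
qed

lemma compatible_uniformity_nbhd:
  assumes "compatible_uniformity X \<U>" "E \<in> \<U>" "x \<in> topspace X"
  shows "\<exists>V. openin X V \<and> x \<in> V \<and> V \<subseteq> E `` {x}"
proof -
  note u = compatible_uniformityD[OF assms(1)]
  define V where "V = {y \<in> topspace X. \<exists>D\<in>\<U>. D `` {y} \<subseteq> E `` {x}}"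
  have "\<exists>D\<in>\<U>. D `` {y} \<subseteq> V" if "y \<in> V" for y
  proof -
    from that obtain D where D: "D \<in> \<U>" "D `` {y} \<subseteq> E `` {x}"
      by (auto simp: V_def)
    obtain C where C: "C \<in> \<U>" "C O C \<subseteq> D"
      using u(7)[OF D(1)] by blast
    have "C `` {y} \<subseteq> V"
    proof
      fix z assume z: "z \<in> C `` {y}"
      then have "z \<in> topspace X" using u(3)[OF C(1)] by blast
      moreover have "C `` {z} \<subseteq> E `` {x}" using z C(2) D(2) by blast
      ultimately show "z \<in> V" using C(1) by (auto simp: V_def)
    qed
    then show ?thesis using C(1) by blast
  qed
  moreover have "V \<subseteq> topspace X" by (auto simp: V_def)
  ultimately have "openin X V" using u(8) by simp
  moreover have "x \<in> V" using assms by (auto simp: V_def)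
  moreover have "V \<subseteq> E `` {x}"
  proof
    fix y assume "y \<in> V"
    then obtain D where "D \<in> \<U>" "D `` {y} \<subseteq> E `` {x}" "y \<in> topspace X"
      by (auto simp: V_def)
    moreover have "(y, y) \<in> D" using u(2) calculation by simp
    ultimately show "y \<in> E `` {x}" by blast
  qed
  ultimately show ?thesis by blast
qed

lemma compatible_uniformity_eq:
  assumes X: "compact_space X" and U: "compatible_uniformity X \<U>"
  shows "\<U> = {E. E \<subseteq> topspace X \<times> topspace X \<and>
     (\<exists>W. openin (prod_topology X X) W \<and> Id_on (topspace X) \<subseteq> W \<and> W \<subseteq> E)}" (is "_ = ?N")
proof (intro equalityI subsetI)
  note u = compatible_uniformityD[OF U]
  fix E assume E: "E \<in> \<U>"
  obtain D0 where D0: "D0 \<in> \<U>" "D0 O D0 \<subseteq> E" using u(7)[OF E] by blast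
  define D where "D = D0 \<inter> D0\<inverse>"
  have D: "D \<in> \<U>" using u(5)[OF D0(1) u(6)[OF D0(1)]] unfolding D_def .
  have "\<forall>x\<in>topspace X. \<exists>V. openin X V \<and> x \<in> V \<and> V \<subseteq> D `` {x}"
    using compatible_uniformity_nbhd[OF U D] by blast
  then obtain V where V: "\<And>x. x \<in> topspace X \<Longrightarrow> openin X (V x) \<and> x \<in> V x \<and> V x \<subseteq> D `` {x}"
    by metis
  have "openin (prod_topology X X) (\<Union>x\<in>topspace X. V x \<times> V x)"
    using V by (intro openin_Union) (auto simp: openin_prod_Times_iff)
  moreover have "Id_on (topspace X) \<subseteq> (\<Union>x\<in>topspace X. V x \<times> V x)"
    using V by auto
  moreover have "(\<Union>x\<in>topspace X. V x \<times> V x) \<subseteq> E"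
  proof clarify
    fix x y z assume "x \<in> topspace X" "y \<in> V x" "z \<in> V x"
    then have "(x, y) \<in> D" "(x, z) \<in> D" using V by blast+
    then show "(y, z) \<in> E" using D0(2) by (auto simp: D_def)
  qed
  ultimately show "E \<in> ?N" using u(3)[OF E] by blast
next
  note u = compatible_uniformityD[OF U]
  fix E assume "E \<in> ?N"
  then obtain W where W: "openin (prod_topology X X) W" "Id_on (topspace X) \<subseteq> W" "W \<subseteq> E"
    and E: "E \<subseteq> topspace X \<times> topspace X" by blast
  have "\<exists>D\<in>\<U>. \<exists>V. openin X V \<and> x \<in> V \<and> V \<subseteq> D `` {x} \<and> (D O D) `` {x} \<times> (D O D) `` {x} \<subseteq> W"
    if x: "x \<in> topspace X" for x
  proof -
    have xW: "(x, x) \<in> W" using W(2) x by auto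
    obtain A B where AB: "openin X A" "openin X B" "x \<in> A" "x \<in> B" "A \<times> B \<subseteq> W"
      using W(1)[unfolded openin_prod_topology_alt, rule_format, OF xW] by (elim exE conjE)
    then have "openin X (A \<inter> B)" "x \<in> A \<inter> B" by auto
    then obtain C where C: "C \<in> \<U>" "C `` {x} \<subseteq> A \<inter> B" using u(8) by blast
    then obtain D where D: "D \<in> \<U>" "D O D \<subseteq> C" using u(7) by blast
    have "(D O D) `` {x} \<times> (D O D) `` {x} \<subseteq> W" using C D AB by blast
    then show ?thesis using D(1) compatible_uniformity_nbhd[OF U D(1) x] by blast
  qed
  then obtain D V where DV: "\<And>x. x \<in> topspace X \<Longrightarrow> D x \<in> \<U> \<and> openin X (V x) \<and> x \<in> V x \<and>
      V x \<subseteq> D x `` {x} \<and> (D x O D x) `` {x} \<times> (D x O D x) `` {x} \<subseteq> W"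
    by metis
  have "\<exists>\<F>. finite \<F> \<and> \<F> \<subseteq> V ` topspace X \<and> topspace X \<subseteq> \<Union>\<F>"
    using X DV by (intro compactinD) (auto simp: compact_space_def)
  then obtain T where T: "finite T" "T \<subseteq> topspace X" "topspace X \<subseteq> (\<Union>x\<in>T. V x)"
    by (metis finite_subset_image)
  define C where "C = topspace X \<times> topspace X \<inter> (\<Inter>x\<in>T. D x)"
  have top: "topspace X \<times> topspace X \<in> \<U>" using u(1,3,4) by blast
  have "C \<in> \<U>" unfolding C_def using T(1,2)
  proof (induction T rule: finite_induct)
    case (insert x T)
    then have "topspace X \<times> topspace X \<inter> (\<Inter>x\<in>T. D x) \<in> \<U>" "D x \<in> \<U>" using DV by auto
    then have "D x \<inter> (topspace X \<times> topspace X \<inter> (\<Inter>x\<in>T. D x)) \<in> \<U>" using u(5) by blast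
    then show ?case by (simp add: Int_left_commute)
  qed (use top in simp)
  moreover have "C \<subseteq> E"
  proof
    fix p assume p: "p \<in> C"
    obtain y z where yz: "p = (y, z)" by fastforce
    then have "y \<in> topspace X" using p by (auto simp: C_def)
    then obtain x where x: "x \<in> T" "y \<in> V x" using T by blast
    then have xX: "x \<in> topspace X" using T by blast
    have xy: "(x, y) \<in> D x" using DV[OF xX] x by blast
    have "y \<in> topspace X" by fact
    then have "(y, y) \<in> D x" using u(2) DV[OF xX] by simp
    then have "y \<in> (D x O D x) `` {x}" using xy by blast
    moreover have "(y, z) \<in> D x" using p x yz by (auto simp: C_def)
    then have "z \<in> (D x O D x) `` {x}" using xy by blast
    ultimately show "p \<in> E" using DV[OF xX] W(3) yz by blast
  qed
  ultimately show "E \<in> \<U>" using u(4) E by blast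
qed

lemma compatible_uniformity_exists:
  assumes X: "completely_regular_space X"
  shows "\<exists>\<U>. compatible_uniformity X \<U>"
proof -
  define B where "B \<F> e = {(x, y) \<in> topspace X \<times> topspace X. \<forall>F\<in>\<F>. \<bar>F x - F y\<bar> < e}"
    for \<F> :: "('a \<Rightarrow> real) set" and e
  define P where "P \<F> e \<longleftrightarrow> finite \<F> \<and> (\<forall>F\<in>\<F>. continuous_map X euclideanreal F) \<and> e > 0"
    for \<F> :: "('a \<Rightarrow> real) set" and e :: real
  define \<U> where "\<U> = {E. E \<subseteq> topspace X \<times> topspace X \<and> (\<exists>\<F> e. P \<F> e \<and> B \<F> e \<subseteq> E)}"
  have BU: "B \<F> e \<in> \<U>" if "P \<F> e" for \<F> e
    using that by (auto simp: \<U>_def B_def)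
  have "is_uniformity (topspace X) \<U>"
    unfolding is_uniformity_def
  proof (intro conjI ballI allI impI)
    have "P {} 1" by (auto simp: P_def)
    then show "\<U> \<noteq> {}" using BU by blast
  next
    fix E assume E: "E \<in> \<U>"
    then obtain \<F> e where Fe: "P \<F> e" "B \<F> e \<subseteq> E" "E \<subseteq> topspace X \<times> topspace X"
      by (auto simp: \<U>_def)
    then show "Id_on (topspace X) \<subseteq> E" by (auto simp: B_def P_def)
    show "E \<subseteq> topspace X \<times> topspace X" by fact
    show "F \<in> \<U>" if "E \<subseteq> F \<and> F \<subseteq> topspace X \<times> topspace X" for F
      using that Fe unfolding \<U>_def by blast
    have "B \<F> e \<subseteq> E\<inverse>"
      using Fe(2) by (auto simp: B_def abs_minus_commute)
    then show "E\<inverse> \<in> \<U>" using Fe unfolding \<U>_def by blast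
    have "P \<F> (e/2)" using Fe by (auto simp: P_def)
    moreover have "B \<F> (e/2) O B \<F> (e/2) \<subseteq> B \<F> e"
      unfolding B_def by (clarsimp, smt (verit, best) field_sum_of_halves)
    ultimately show "\<exists>D\<in>\<U>. D O D \<subseteq> E" using BU Fe by blast
    fix E' assume "E' \<in> \<U>"
    then obtain \<F>' e' where Fe': "P \<F>' e'" "B \<F>' e' \<subseteq> E'" "E' \<subseteq> topspace X \<times> topspace X"
      by (auto simp: \<U>_def)
    have "P (\<F> \<union> \<F>') (min e e')" using Fe Fe' by (auto simp: P_def)
    moreover have "B (\<F> \<union> \<F>') (min e e') \<subseteq> B \<F> e \<inter> B \<F>' e'" by (auto simp: B_def)
    ultimately show "E \<inter> E' \<in> \<U>"
      using Fe Fe' unfolding \<U>_def by blast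
  qed
  moreover have "openin X U \<longleftrightarrow> U \<subseteq> topspace X \<and> (\<forall>x\<in>U. \<exists>E\<in>\<U>. E `` {x} \<subseteq> U)" for U
  proof
    assume U: "openin X U"
    have "\<exists>E\<in>\<U>. E `` {x} \<subseteq> U" if x: "x \<in> U" for x
    proof -
      have "closedin X (topspace X - U)" "x \<in> topspace X - (topspace X - U)"
        using U x openin_subset by fastforce+
      then obtain f where f: "continuous_map X (top_of_set {0..1::real}) f" "f x = 0"
        "f ` (topspace X - U) \<subseteq> {1}"
        using X unfolding completely_regular_space_def by (metis image_subset_iff_funcset)
      then have "P {f} 1" by (auto simp: P_def continuous_map_in_subtopology)
      moreover have "B {f} 1 `` {x} \<subseteq> U" using f by (fastforce simp: B_def)
      ultimately show ?thesis using BU by blast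
    qed
    then show "U \<subseteq> topspace X \<and> (\<forall>x\<in>U. \<exists>E\<in>\<U>. E `` {x} \<subseteq> U)" using U openin_subset by blast
  next
    assume U: "U \<subseteq> topspace X \<and> (\<forall>x\<in>U. \<exists>E\<in>\<U>. E `` {x} \<subseteq> U)"
    have "\<exists>V. openin X V \<and> x \<in> V \<and> V \<subseteq> U" if x: "x \<in> U" for x
    proof -
      obtain \<F> e where Fe: "P \<F> e" "B \<F> e `` {x} \<subseteq> U"
        using U x unfolding \<U>_def by blast
      define V where "V = topspace X \<inter> (\<Inter>F\<in>\<F>. {y \<in> topspace X. F y \<in> ball (F x) e})"
      have "openin X {y \<in> topspace X. F y \<in> ball (F x) e}" if "F \<in> \<F>" for F
        using that Fe by (intro openin_continuous_map_preimage[of _ euclideanreal]) (auto simp: P_def)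
      then have "openin X V" unfolding V_def
        using Fe(1) by (intro openin_Int_Inter) (auto simp: P_def)
      moreover have "x \<in> V" using U x Fe(1) by (auto simp: V_def P_def)
      moreover have "V \<subseteq> U" using Fe(2) U x by (auto simp: V_def B_def dist_real_def)
      ultimately show ?thesis by blast
    qed
    then show "openin X U" by (subst openin_subopen) blast
  qed
  ultimately show ?thesis unfolding compatible_uniformity_def by blast
qed

theorem compact_Hausdorff_unique_uniformity:
  assumes "compact_space X" "Hausdorff_space X"
  shows "\<exists>!\<U>. compatible_uniformity X \<U>"
proof -
  have "completely_regular_space X"
    using assms by (simp add: compact_Hausdorff_or_regular_imp_normal_space normal_imp_completely_regular_space)
  then obtain \<U> where "compatible_uniformity X \<U>"
    using compatible_uniformity_exists by blast
  moreover have "\<V> = \<U>" if "compatible_uniformity X \<V>" for \<V>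
    using compatible_uniformity_eq[OF assms(1) that]
      compatible_uniformity_eq[OF assms(1) \<open>compatible_uniformity X \<U>\<close>] by simp
  ultimately show ?thesis by blast
qed

lemma the_uniformity_eq:
  assumes "compact_space X" "Hausdorff_space X"
  shows "the_uniformity X = {E. E \<subseteq> topspace X \<times> topspace X \<and>
     (\<exists>W. openin (prod_topology X X) W \<and> Id_on (topspace X) \<subseteq> W \<and> W \<subseteq> E)}"
  unfolding the_uniformity_def
  by (rule compatible_uniformity_eq[OF assms(1) theI'[OF compact_Hausdorff_unique_uniformity[OF assms]]])

subsection \<open>SUC spaces and \<open>SUC(G)\<close>\<close>

definition SUC_space :: "'y topology \<Rightarrow> ('g::topological_group_add \<Rightarrow> 'y \<Rightarrow> 'y) \<Rightarrow> bool" where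
  "SUC_space Y act \<longleftrightarrow> compact_G_space Y act \<and>
     (\<forall>y0\<in>topspace Y. \<forall>\<epsilon>\<in>the_uniformity Y. \<forall>\<^sub>F u in nhds 0. \<forall>g. (act (g + u) y0, act g y0) \<in> \<epsilon>)"

text \<open>
  HOL cannot quantify over the types of the points of \<open>Y\<close>. Letting \<open>Y\<close> range over the topologies
  (with arbitrary \<^const>\<open>topspace\<close>) on the single type \<open>('g \<Rightarrow> real) \<Rightarrow> real\<close> is no restriction, by
  \<open>SUC_anytype\<close> below.
\<close>

definition SUC :: "('g::topological_group_add \<Rightarrow> real) set" where
  "SUC = {f. continuous_on UNIV f \<and> bounded (range f) \<and>
     (\<exists>(Y :: (('g \<Rightarrow> real) \<Rightarrow> real) topology) act \<nu> F.
        SUC_space Y act \<and> dense_G_map Y act \<nu> \<and> continuous_map Y euclideanreal F \<and> f = F \<circ> \<nu>)}"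

lemma SUC_space_transport:
  fixes act :: "'g::topological_group_add \<Rightarrow> 'a \<Rightarrow> 'a"
  assumes Y: "SUC_space Y act" and h: "homeomorphic_maps Y Z e r"
  shows "SUC_space Z (\<lambda>g z. e (act g (r z)))"
proof -
  have e: "continuous_map Y Z e" and r: "continuous_map Z Y r"
    and re: "\<And>y. y \<in> topspace Y \<Longrightarrow> r (e y) = y" and er: "\<And>z. z \<in> topspace Z \<Longrightarrow> e (r z) = z"
    using h by (auto simp: homeomorphic_maps_def)
  have eT: "\<And>y. y \<in> topspace Y \<Longrightarrow> e y \<in> topspace Z" and rT: "\<And>z. z \<in> topspace Z \<Longrightarrow> r z \<in> topspace Y"
    using e r by (auto simp: continuous_map_def)
  have YZ: "Y homeomorphic_space Z" unfolding homeomorphic_space_def using h by (intro exI)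
  have YH: "compact_space Y" "Hausdorff_space Y" "completely_regular_space Y"
    and c: "continuous_map (prod_topology euclidean Y) Y (\<lambda>(g, x). act g x)"
    and a0: "\<And>x. x \<in> topspace Y \<Longrightarrow> act 0 x = x"
    and aa: "\<And>g h x. x \<in> topspace Y \<Longrightarrow> act (g + h) x = act g (act h x)"
    using Y by (auto simp: SUC_space_def compact_G_space_def G_space_def)
  have ZH: "compact_space Z" "Hausdorff_space Z" "completely_regular_space Z"
    using YH homeomorphic_compact_space[OF YZ] homeomorphic_Hausdorff_space[OF YZ]
      homeomorphic_completely_regular_space[OF YZ] by simp_all
  have aT: "act g y \<in> topspace Y" if "y \<in> topspace Y" for g y
    using funcset_mem[OF continuous_map_funspace[OF c], of "(g, y)"] that by simp
  have "continuous_map (prod_topology euclidean Z) (prod_topology euclidean Y) (\<lambda>p. (fst p, (r \<circ> snd) p))"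
    by (intro continuous_map_pairedI continuous_map_compose[OF continuous_map_snd r])
       (simp add: continuous_map_fst)
  then have "continuous_map (prod_topology euclidean Z) Z
      (e \<circ> ((\<lambda>(g, x). act g x) \<circ> (\<lambda>p. (fst p, (r \<circ> snd) p))))"
    by (rule continuous_map_compose[OF continuous_map_compose[OF _ c] e])
  then have cZ: "continuous_map (prod_topology euclidean Z) Z (\<lambda>(g, z). e (act g (r z)))"
    by (simp add: o_def case_prod_unfold)
  have "G_space Z (\<lambda>g z. e (act g (r z)))"
    unfolding G_space_def using ZH cZ by (auto simp: a0 aa er re rT aT)
  moreover have "\<forall>\<^sub>F u in nhds 0. \<forall>g. (e (act (g + u) (r z)), e (act g (r z))) \<in> E"
    if z: "z \<in> topspace Z" and E: "E \<in> the_uniformity Z" for z E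
  proof -
    obtain W where W: "openin (prod_topology Z Z) W" "Id_on (topspace Z) \<subseteq> W" "W \<subseteq> E"
      using E the_uniformity_eq[OF ZH(1,2)] by auto
    define D where "D = {p \<in> topspace (prod_topology Y Y). ((e \<circ> fst) p, (e \<circ> snd) p) \<in> W}"
    have "continuous_map (prod_topology Y Y) (prod_topology Z Z) (\<lambda>p. ((e \<circ> fst) p, (e \<circ> snd) p))"
      by (intro continuous_map_pairedI continuous_map_compose[OF continuous_map_fst e]
          continuous_map_compose[OF continuous_map_snd e])
    then have "openin (prod_topology Y Y) D"
      unfolding D_def using W(1) by (rule openin_continuous_map_preimage)
    moreover have "Id_on (topspace Y) \<subseteq> D" using W(2) eT by (auto simp: D_def intro!: subsetD[OF W(2)])
    ultimately have "D \<in> the_uniformity Y"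
      unfolding the_uniformity_eq[OF YH(1,2)] by (auto simp: D_def)
    then have "\<forall>\<^sub>F u in nhds 0. \<forall>g. (act (g + u) (r z), act g (r z)) \<in> D"
      using Y rT[OF z] by (auto simp: SUC_space_def)
    then show ?thesis
      by (rule eventually_mono) (use W(3) in \<open>auto simp: D_def\<close>)
  qed
  ultimately show ?thesis
    using ZH by (auto simp: SUC_space_def compact_G_space_def)
qed

theorem SUC_anytype:
  fixes Y :: "'b topology" and f :: "'g::topological_group_add \<Rightarrow> real"
  assumes Y: "SUC_space Y act" and \<nu>: "dense_G_map Y act \<nu>"
    and F: "continuous_map Y euclideanreal F" and f: "f = F \<circ> \<nu>"
  shows "f \<in> SUC"
proof -
  have YH: "compact_space Y" "Hausdorff_space Y" "completely_regular_space Y"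
    using Y by (auto simp: SUC_space_def compact_G_space_def G_space_def)
  have cv: "continuous_map euclidean Y \<nu>" and dense: "Y closure_of (range \<nu>) = topspace Y"
    and eq: "\<And>g h. \<nu> (g + h) = act g (\<nu> h)"
    using \<nu> by (auto simp: dense_G_map_def G_map_def)
  have vT: "\<And>g. \<nu> g \<in> topspace Y" using cv by (auto simp: continuous_map_def)
  define C where "C = {F. continuous_map Y euclideanreal F}"
  define e :: "'b \<Rightarrow> ('g \<Rightarrow> real) \<Rightarrow> real" where "e y k = (SOME F. F \<in> C \<and> F \<circ> \<nu> = k) y" for y k
  have e: "e y (K \<circ> \<nu>) = K y" if K: "K \<in> C" and y: "y \<in> topspace Y" for y K
  proof -
    define L where "L = (SOME F. F \<in> C \<and> F \<circ> \<nu> = K \<circ> \<nu>)"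
    have L: "L \<in> C \<and> L \<circ> \<nu> = K \<circ> \<nu>"
      unfolding L_def by (rule someI[of _ K]) (use K in simp)
    have "L y = K y"
    proof (rule forall_in_closure_of_eq[of y Y "range \<nu>" euclideanreal])
      show "L x = K x" if "x \<in> range \<nu>" for x
        using that L by (metis comp_apply rangeE)
    qed (use L K y dense in \<open>auto simp: C_def\<close>)
    then show ?thesis by (simp add: e_def L_def)
  qed
  have inj: "inj_on e (topspace Y)"
  proof (rule inj_onI, rule ccontr)
    fix x y assume xy: "x \<in> topspace Y" "y \<in> topspace Y" "e x = e y" "x \<noteq> y"
    have "closedin Y {y}" using YH(2) xy by (simp add: closedin_Hausdorff_sing_eq)
    then obtain K where K: "continuous_map Y (top_of_set {0..1::real}) K" "K x = 0" "K ` {y} \<subseteq> {1}"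
      using YH(3) xy unfolding completely_regular_space_def
      by (metis Diff_iff empty_iff image_subset_iff_funcset insert_iff)
    then have "K \<in> C" by (auto simp: C_def continuous_map_in_subtopology)
    then have "K x = K y" using e xy by metis
    then show False using K by simp
  qed
  define r where "r = inv_into (topspace Y) e"
  define Z where "Z = pullback_topology (e ` topspace Y) r Y"
  have re: "\<And>y. y \<in> topspace Y \<Longrightarrow> r (e y) = y" using inj by (simp add: r_def)
  have TZ: "topspace Z = e ` topspace Y"
    by (auto simp: Z_def topspace_pullback_topology re)
  have cr: "continuous_map Z Y r"
    unfolding Z_def using continuous_map_pullback[of Y Y id "e ` topspace Y" r] by simp
  have ce: "continuous_map Y Z e"
    unfolding Z_def
  proof (rule continuous_map_pullback')
    show "continuous_map Y Y (r \<circ> e)"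
      by (rule continuous_map_eq[of _ _ id]) (auto simp: re)
  qed auto
  have h: "homeomorphic_maps Y Z e r"
    unfolding homeomorphic_maps_def using cr ce re by (auto simp: TZ)
  have "SUC_space Z (\<lambda>g z. e (act g (r z)))" by (rule SUC_space_transport[OF Y h])
  moreover have "dense_G_map Z (\<lambda>g z. e (act g (r z))) (e \<circ> \<nu>)"
    unfolding dense_G_map_def G_map_def
  proof (intro conjI allI ballI)
    show "continuous_map euclidean Z (e \<circ> \<nu>)" using cv ce by (rule continuous_map_compose)
    show "(e \<circ> \<nu>) (g + x) = e (act g (r ((e \<circ> \<nu>) x)))" for g x by (simp add: eq re vT)
    have "homeomorphic_map Y Z e" using h homeomorphic_map_maps by blast
    then have "Z closure_of (e ` range \<nu>) = e ` (Y closure_of range \<nu>)"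
      by (rule homeomorphic_map_closure_of) (use vT in auto)
    then show "Z closure_of range (e \<circ> \<nu>) = topspace Z" by (simp add: dense TZ image_comp)
  qed
  moreover have "continuous_map Z euclideanreal (F \<circ> r)" using cr F by (rule continuous_map_compose)
  moreover have "f = (F \<circ> r) \<circ> (e \<circ> \<nu>)" by (auto simp: f re vT)
  moreover have "continuous_on UNIV f"
    using continuous_map_compose[OF cv F] f by simp
  moreover have "bounded (range f)"
  proof -
    have "compactin euclideanreal (F ` topspace Y)"
      using YH(1) F image_compactin unfolding compact_space_def by blast
    then have "bounded (F ` topspace Y)" by (simp add: compact_imp_bounded)
    then show ?thesis by (rule bounded_subset) (use f vT in auto)
  qed
  ultimately show ?thesis unfolding SUC_def by blast
qed

end

theory Submission
  imports Defs
begin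

text \<open>
  A multiplication \<open>m\<close> amounts to a choice, for each \<open>p\<close>, of a \<open>G\<close>-map \<open>s \<mapsto> m s p\<close> sending \<open>i(e)\<close>
  to \<open>p\<close>; by density such a map is unique, which yields associativity. Pulling back entourages
  along these maps reduces the SUC property at \<open>p\<close> to the one at \<open>i(e)\<close>, where it is the
  uniform continuity of the functions in \<open>UC(G)\<close>. Finally, if \<open>f = F \<circ> \<nu>\<close> comes from an SUC
  space \<open>Y\<close>, then for every \<open>p\<close> in \<open>G\<^sup>U\<^sup>C\<close> the function \<open>h \<mapsto> p(f(h \<cdot>))\<close> is an orbit function
  \<open>h \<mapsto> F(hy)\<close> with \<open>y\<close> in \<open>Y\<close> and hence lies in \<open>UC(G)\<close>; if this holds for all \<open>f\<close> in
  \<open>UC(G)\<close>, then the \<open>G\<close>-map through \<open>p\<close> can be defined by a convolution formula.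
\<close>

section \<open>Uniformly continuous functions\<close>

text \<open>The suprema in the definition range over bounded families, so a bound on them and a
  bound for every \<open>g\<close> differ only by strictness. Continuity comes for free from the
  left uniform condition.\<close>

lemma UC_iff:
  "f \<in> UC \<longleftrightarrow> bounded (range f) \<and>
     (\<forall>\<epsilon>>0. \<forall>\<^sub>F v in nhds 0. \<forall>g. \<bar>f (v + g) - f g\<bar> < \<epsilon> \<and> \<bar>f (g + v) - f g\<bar> < \<epsilon>)"
  (is "_ \<longleftrightarrow> _ \<and> ?U")
proof
  assume f: "f \<in> UC"
  then have b: "bounded (range f)" by (simp add: UC_def)
  then obtain c where c: "\<And>x. \<bar>f x\<bar> \<le> c" by (auto simp: bounded_iff)
  have c2: "\<bar>f x - f y\<bar> \<le> 2 * c" for x y using c[of x] c[of y] by linarith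
  have bdd: "bdd_above (range (\<lambda>g. \<bar>f (v + g) - f g\<bar>))" "bdd_above (range (\<lambda>g. \<bar>f (g + v) - f g\<bar>))" for v
    by (auto intro!: bdd_aboveI[of _ "2 * c"] c2)
  have ?U
  proof (intro allI impI)
    fix \<epsilon> :: real assume "\<epsilon> > 0"
    then have "\<forall>\<^sub>F v in nhds 0. (SUP g. \<bar>f (v + g) - f g\<bar>) < \<epsilon> \<and> (SUP g. \<bar>f (g + v) - f g\<bar>) < \<epsilon>"
      using f by (simp add: UC_def)
    then show "\<forall>\<^sub>F v in nhds 0. \<forall>g. \<bar>f (v + g) - f g\<bar> < \<epsilon> \<and> \<bar>f (g + v) - f g\<bar> < \<epsilon>"
      by (rule eventually_mono) (use bdd in \<open>meson UNIV_I cSUP_upper order.strict_trans1\<close>)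
  qed
  with b show "bounded (range f) \<and> ?U" by blast
next
  assume "bounded (range f) \<and> ?U"
  then have b: "bounded (range f)" and u: ?U by blast+
  have "(f \<longlongrightarrow> f x) (at x)" for x
  proof -
    have "(f \<longlongrightarrow> f x) (nhds x)"
    proof (rule tendstoI)
      fix \<epsilon> :: real assume "\<epsilon> > 0"
      with u have "\<forall>\<^sub>F v in nhds 0. \<bar>f (v + x) - f x\<bar> < \<epsilon>"
        by (metis (mono_tags, lifting) eventually_mono)
      \<comment> \<open>Writing \<open>y\<close> as \<open>(y - x) + x\<close> turns closeness to
        \<open>x\<close> into a small left translation.\<close>
      moreover have "filterlim (\<lambda>y. y - x) (nhds 0) (nhds x)"
        using tendsto_diff[OF filterlim_ident[of "nhds x"] tendsto_const[of x]] by simp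
      ultimately have "\<forall>\<^sub>F y in nhds x. \<bar>f ((y - x) + x) - f x\<bar> < \<epsilon>"
        by (rule eventually_compose_filterlim)
      then show "\<forall>\<^sub>F y in nhds x. dist (f y) (f x) < \<epsilon>" by (simp add: dist_real_def)
    qed
    then show ?thesis
      by (rule tendsto_mono[rotated]) (simp add: at_within_le_nhds)
  qed
  then have "continuous_on UNIV f" by (simp add: continuous_on_def)
  moreover have "\<forall>\<^sub>F v in nhds 0. (SUP g. \<bar>f (v + g) - f g\<bar>) < \<epsilon> \<and> (SUP g. \<bar>f (g + v) - f g\<bar>) < \<epsilon>"
    if e: "\<epsilon> > 0" for \<epsilon>
  proof -
    \<comment> \<open>Strict bounds for all \<open>g\<close> only give a weak bound for the
      supremum; halving \<open>\<epsilon>\<close> restores strictness.\<close>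
    have "\<forall>\<^sub>F v in nhds 0. \<forall>g. \<bar>f (v + g) - f g\<bar> < \<epsilon> / 2 \<and> \<bar>f (g + v) - f g\<bar> < \<epsilon> / 2"
      using u half_gt_zero[OF e] by blast
    then show ?thesis
    proof (rule eventually_mono)
      fix v assume v: "\<forall>g. \<bar>f (v + g) - f g\<bar> < \<epsilon> / 2 \<and> \<bar>f (g + v) - f g\<bar> < \<epsilon> / 2"
      have "(SUP g. \<bar>f (v + g) - f g\<bar>) \<le> \<epsilon> / 2" "(SUP g. \<bar>f (g + v) - f g\<bar>) \<le> \<epsilon> / 2"
        by (rule cSUP_least, simp, use v in \<open>blast intro: less_imp_le\<close>)+
      then show "(SUP g. \<bar>f (v + g) - f g\<bar>) < \<epsilon> \<and> (SUP g. \<bar>f (g + v) - f g\<bar>) < \<epsilon>"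
        using e by linarith
    qed
  qed
  ultimately show "f \<in> UC" using b by (simp add: UC_def)
qed

lemma UC_continuous: "f \<in> UC \<Longrightarrow> continuous_on UNIV f"
  by (simp add: UC_def)

lemma UC_bounded: "f \<in> UC \<Longrightarrow> \<exists>c. \<forall>x. \<bar>f x\<bar> \<le> c"
  by (auto simp: UC_iff bounded_iff)

lemma UC_eventually:
  assumes "f \<in> UC" "\<epsilon> > 0"
  shows "\<forall>\<^sub>F v in nhds 0. \<forall>g. \<bar>f (v + g) - f g\<bar> < \<epsilon>" "\<forall>\<^sub>F v in nhds 0. \<forall>g. \<bar>f (g + v) - f g\<bar> < \<epsilon>"
proof -
  have "\<forall>\<^sub>F v in nhds 0. \<forall>g. \<bar>f (v + g) - f g\<bar> < \<epsilon> \<and> \<bar>f (g + v) - f g\<bar> < \<epsilon>"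
    using assms by (simp add: UC_iff)
  then show "\<forall>\<^sub>F v in nhds 0. \<forall>g. \<bar>f (v + g) - f g\<bar> < \<epsilon>" "\<forall>\<^sub>F v in nhds 0. \<forall>g. \<bar>f (g + v) - f g\<bar> < \<epsilon>"
    by (rule eventually_mono; blast)+
qed

section \<open>Closure properties of UC(G)\<close>

text \<open>The values of \<open>f\<close> and \<open>h\<close> lie in a compact box, on which
  \<open>K\<close> is uniformly continuous. Choosing \<open>K\<close> suitably yields the algebra
  operations, and through \<open>UC_compose\<close> the square root.\<close>

lemma UC_compose2:
  fixes K :: "real \<times> real \<Rightarrow> real"
  assumes K: "continuous_on UNIV K" and f: "f \<in> UC" and h: "h \<in> UC"
  shows "(\<lambda>x. K (f x, h x)) \<in> UC"
proof -
  obtain a b where ab: "\<And>x. \<bar>f x\<bar> \<le> a" "\<And>x. \<bar>h x\<bar> \<le> b" using UC_bounded f h by metis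
  define C where "C = {-a..a} \<times> {-b..b}"
  have C: "compact C" unfolding C_def by (intro compact_Times compact_Icc)
  have inC: "(f x, h x) \<in> C" for x
    using ab(1)[of x] ab(2)[of x] by (auto simp: C_def abs_le_iff)
  have KC: "continuous_on C K" using K continuous_on_subset by blast
  have "bounded (K ` C)" using compact_continuous_image[OF KC C] compact_imp_bounded by blast
  then have b: "bounded (range (\<lambda>x. K (f x, h x)))" by (rule bounded_subset) (use inC in auto)
  have "\<forall>\<^sub>F v in nhds 0. \<forall>g. \<bar>K (f (v + g), h (v + g)) - K (f g, h g)\<bar> < \<epsilon> \<and>
      \<bar>K (f (g + v), h (g + v)) - K (f g, h g)\<bar> < \<epsilon>" if "\<epsilon> > 0" for \<epsilon>
  proof -
    obtain d where d: "d > 0" "\<And>p q. p \<in> C \<Longrightarrow> q \<in> C \<Longrightarrow> dist q p < d \<Longrightarrow> dist (K q) (K p) < \<epsilon>"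
      using compact_uniformly_continuous[OF KC C] \<open>\<epsilon> > 0\<close> unfolding uniformly_continuous_on_def
      by (elim allE[of _ \<epsilon>]) blast
    have K2: "\<bar>K (f x, h x) - K (f y, h y)\<bar> < \<epsilon>" if "\<bar>f x - f y\<bar> < d / 2" "\<bar>h x - h y\<bar> < d / 2" for x y
    proof -
      have "dist (f x, h x) (f y, h y) \<le> \<bar>f x - f y\<bar> + \<bar>h x - h y\<bar>"
        unfolding dist_Pair_Pair dist_real_def by (metis abs_abs sqrt_sum_squares_le_sum_abs)
      also have "\<dots> < d" using that by linarith
      finally show ?thesis using d(2)[OF inC inC] by (simp add: dist_real_def)
    qed
    have "d / 2 > 0" using d(1) by simp
    note ev = UC_eventually[OF f this] UC_eventually[OF h this]
    show ?thesis using ev by eventually_elim (use K2 in blast)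
  qed
  then show ?thesis using b by (simp add: UC_iff)
qed

lemma UC_const: "(\<lambda>x. c) \<in> UC"
  by (simp add: UC_iff)

lemma UC_compose:
  assumes "continuous_on UNIV (K :: real \<Rightarrow> real)" "f \<in> UC"
  shows "(\<lambda>x. K (f x)) \<in> UC"
  using UC_compose2[of "\<lambda>p. K (fst p)", OF _ assms(2) assms(2)] assms(1)
  by (simp add: continuous_on_compose2[OF assms(1) continuous_on_fst[OF continuous_on_id]])

lemma UC_add: "f \<in> UC \<Longrightarrow> h \<in> UC \<Longrightarrow> (\<lambda>x. f x + h x) \<in> UC"
  using UC_compose2[of "\<lambda>p. fst p + snd p" f h] by (simp add: continuous_intros)

lemma UC_mult: "f \<in> UC \<Longrightarrow> h \<in> UC \<Longrightarrow> (\<lambda>x. f x * h x) \<in> UC"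
  using UC_compose2[of "\<lambda>p. fst p * snd p" f h] by (simp add: continuous_intros)

lemma UC_diff: "f \<in> UC \<Longrightarrow> h \<in> UC \<Longrightarrow> (\<lambda>x. f x - h x) \<in> UC"
  using UC_compose2[of "\<lambda>p. fst p - snd p" f h] by (simp add: continuous_intros)

lemma UC_cmult: "f \<in> UC \<Longrightarrow> (\<lambda>x. c * f x) \<in> UC"
  by (rule UC_mult[OF UC_const])

lemma UC_sum: "(\<And>k. k \<in> I \<Longrightarrow> F k \<in> UC) \<Longrightarrow> (\<lambda>x. \<Sum>k\<in>I. F k x) \<in> UC"
  by (induction I rule: infinite_finite_induct) (auto intro: UC_const UC_add)

text \<open>For the left condition, \<open>a + v + g = (a + v - a) + (a + g)\<close>: the translate
  is moved by the conjugate of \<open>v\<close>, and conjugation by \<open>a\<close> is continuous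
  at the neutral element.\<close>

lemma UC_translate:
  assumes f: "f \<in> UC"
  shows "(\<lambda>h. f (a + h)) \<in> UC"
proof -
  have "bounded (range (\<lambda>h. f (a + h)))"
    using f by (auto simp: UC_iff intro: bounded_subset)
  moreover have "\<forall>\<^sub>F v in nhds 0. \<forall>g. \<bar>f (a + (v + g)) - f (a + g)\<bar> < \<epsilon> \<and> \<bar>f (a + (g + v)) - f (a + g)\<bar> < \<epsilon>"
    if e: "\<epsilon> > 0" for \<epsilon>
  proof -
    have "filterlim (\<lambda>v. a + v - a) (nhds (a + 0 - a)) (nhds 0)"
      by (intro tendsto_diff tendsto_add tendsto_const filterlim_ident)
    then have "filterlim (\<lambda>v. a + v - a) (nhds 0) (nhds 0)" by simp
    then have "\<forall>\<^sub>F v in nhds 0. \<forall>g. \<bar>f ((a + v - a) + g) - f g\<bar> < \<epsilon>"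
      by (rule eventually_compose_filterlim[OF UC_eventually(1)[OF f e]])
    then show ?thesis using UC_eventually(2)[OF f e]
    proof eventually_elim
      case (elim v)
      have "a + (v + g) = (a + v - a) + (a + g)" for g
        by (metis add.assoc diff_add_cancel)
      then show ?case using elim by (metis add.assoc)
    qed
  qed
  ultimately show ?thesis by (simp add: UC_iff)
qed

section \<open>The compactification\<close>

text \<open>A multiplicative functional is nonzero exactly when it is unital, because
  \<open>f = f * 1\<close>. Unlike being nonzero, the equation at the constant 1 is a closed
  condition, as compactness requires.\<close>

lemma topspace_GUC:
  "\<phi> \<in> topspace GUC \<longleftrightarrow> \<phi> \<in> extensional UC \<and>
     (\<forall>f\<in>UC. \<forall>h\<in>UC. \<phi> (\<lambda>x. f x + h x) = \<phi> f + \<phi> h) \<and>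
     (\<forall>c. \<forall>f\<in>UC. \<phi> (\<lambda>x. c * f x) = c * \<phi> f) \<and>
     (\<forall>f\<in>UC. \<forall>h\<in>UC. \<phi> (\<lambda>x. f x * h x) = \<phi> f * \<phi> h) \<and>
     \<phi> (\<lambda>x. 1) = 1"
proof -
  have "(\<exists>f\<in>UC. \<phi> f \<noteq> 0) \<longleftrightarrow> \<phi> (\<lambda>x. 1) = 1"
    if "\<forall>f\<in>UC. \<forall>h\<in>UC. \<phi> (\<lambda>x. f x * h x) = \<phi> f * \<phi> h"
  proof
    assume "\<exists>f\<in>UC. \<phi> f \<noteq> 0"
    then obtain f where f: "f \<in> UC" "\<phi> f \<noteq> 0" by blast
    have "\<phi> (\<lambda>x. f x * 1) = \<phi> f * \<phi> (\<lambda>x. 1)" using bspec[OF bspec[OF that f(1)] UC_const] .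
    then show "\<phi> (\<lambda>x. 1) = 1" using f by simp
  qed (auto intro!: bexI[of _ "\<lambda>x. 1"] UC_const)
  then show ?thesis by (auto simp: gelfand_space_def PiE_def)
qed

lemma GUC_add: "\<lbrakk>\<phi> \<in> topspace GUC; f \<in> UC; h \<in> UC\<rbrakk> \<Longrightarrow> \<phi> (\<lambda>x. f x + h x) = \<phi> f + \<phi> h"
  and GUC_cmult: "\<lbrakk>\<phi> \<in> topspace GUC; f \<in> UC\<rbrakk> \<Longrightarrow> \<phi> (\<lambda>x. c * f x) = c * \<phi> f"
  and GUC_mult: "\<lbrakk>\<phi> \<in> topspace GUC; f \<in> UC; h \<in> UC\<rbrakk> \<Longrightarrow> \<phi> (\<lambda>x. f x * h x) = \<phi> f * \<phi> h"
  and GUC_one: "\<phi> \<in> topspace GUC \<Longrightarrow> \<phi> (\<lambda>x. 1) = 1"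
  and GUC_extensional: "\<phi> \<in> topspace GUC \<Longrightarrow> \<phi> \<in> extensional UC"
  by (auto simp: topspace_GUC)

lemma GUC_const: "\<phi> \<in> topspace GUC \<Longrightarrow> \<phi> (\<lambda>x. c) = c"
  using GUC_cmult[OF _ UC_const, of \<phi> c 1] by (simp add: GUC_one)

lemma GUC_diff:
  assumes "\<phi> \<in> topspace GUC" "f \<in> UC" "h \<in> UC"
  shows "\<phi> (\<lambda>x. f x - h x) = \<phi> f - \<phi> h"
  using GUC_add[OF assms(1) UC_diff[OF assms(2,3)] assms(3)] by simp

text \<open>Serves the sum of squares in the proof of density. For infinite \<open>I\<close> both
  sums are 0 by convention.\<close>

lemma GUC_sum:
  assumes "\<phi> \<in> topspace GUC" "\<And>k. k \<in> I \<Longrightarrow> F k \<in> UC"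
  shows "\<phi> (\<lambda>x. \<Sum>k\<in>I. F k x) = (\<Sum>k\<in>I. \<phi> (F k))"
  using assms(2)
proof (induction I rule: infinite_finite_induct)
  case (insert k I)
  then have "\<phi> (\<lambda>x. F k x + (\<Sum>k\<in>I. F k x)) = \<phi> (F k) + \<phi> (\<lambda>x. \<Sum>k\<in>I. F k x)"
    by (intro GUC_add assms(1) UC_sum) auto
  then show ?case using insert by simp
qed (simp_all add: GUC_const assms(1))

text \<open>A nonnegative \<open>f\<close> is the square of \<open>sqrt f\<close>, which lies in
  \<open>UC\<close> again, so its value is a square.\<close>

lemma GUC_nonneg:
  assumes "\<phi> \<in> topspace GUC" "f \<in> UC" "\<And>x. f x \<ge> 0"
  shows "\<phi> f \<ge> 0"
proof -
  have "(\<lambda>x. sqrt (f x)) \<in> UC"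
    by (rule UC_compose) (auto intro: continuous_intros assms)
  then have "\<phi> (\<lambda>x. sqrt (f x) * sqrt (f x)) \<ge> 0"
    by (subst GUC_mult[OF assms(1)]) simp_all
  then show ?thesis using assms(3) by simp
qed

lemma GUC_mono:
  assumes "\<phi> \<in> topspace GUC" "f \<in> UC" "h \<in> UC" "\<And>x. f x \<le> h x"
  shows "\<phi> f \<le> \<phi> h"
  using GUC_nonneg[OF assms(1) UC_diff[OF assms(3,2)]] GUC_diff[OF assms(1,3,2)] assms(4) by simp

text \<open>Positivity and unitality make every point of the Gelfand space a contraction for the
  supremum norm.\<close>

lemma GUC_dist_le:
  assumes "\<phi> \<in> topspace GUC" "f \<in> UC" "h \<in> UC" "\<And>x. \<bar>f x - h x\<bar> \<le> c"
  shows "\<bar>\<phi> f - \<phi> h\<bar> \<le> c"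
proof -
  have "- c \<le> f x - h x" for x using abs_le_D2[OF assms(4), of x] by linarith
  then have "\<phi> (\<lambda>x. f x - h x) \<le> c" "-c \<le> \<phi> (\<lambda>x. f x - h x)"
    using GUC_mono[OF assms(1) UC_diff[OF assms(2,3)] UC_const, of c]
      GUC_mono[OF assms(1) UC_const UC_diff[OF assms(2,3)], of "-c"] abs_le_D1[OF assms(4)]
    by (simp_all add: GUC_const assms(1))
  then show ?thesis by (simp add: GUC_diff assms)
qed

section \<open>Topology of the Gelfand space\<close>

lemma continuous_map_into_GUC:
  "continuous_map X GUC k \<longleftrightarrow> (\<forall>x\<in>topspace X. k x \<in> topspace GUC) \<and>
     (\<forall>f\<in>UC. continuous_map X euclideanreal (\<lambda>x. k x f))"
  unfolding gelfand_space_def continuous_map_in_subtopology continuous_map_componentwise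
  by (simp add: PiE_def Pi_iff image_subset_iff) blast

lemma continuous_map_GUC_eval:
  assumes "f \<in> UC"
  shows "continuous_map GUC euclideanreal (\<lambda>\<phi>. \<phi> f)"
  unfolding gelfand_space_def
  by (intro continuous_map_from_subtopology continuous_map_product_projection assms)

lemma GUC_eqI:
  assumes "\<phi> \<in> topspace GUC" "\<psi> \<in> topspace GUC" "\<And>f. f \<in> UC \<Longrightarrow> \<phi> f = \<psi> f"
  shows "\<phi> = \<psi>"
  using GUC_extensional[OF assms(1)] GUC_extensional[OF assms(2)] assms(3) by (rule extensionalityI)

lemma Hausdorff_GUC: "Hausdorff_space GUC"
  unfolding gelfand_space_def
  by (intro Hausdorff_space_subtopology) (simp add: Hausdorff_space_product_topology)

text \<open>As in the theorem of Banach and Alaoglu: the Gelfand space is cut out of the product by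
  closed equations and lies in a product of compact intervals.\<close>

lemma compact_GUC: "compact_space (GUC :: (('g::topological_group_add \<Rightarrow> real) \<Rightarrow> real) topology)"
proof -
  let ?P = "product_topology (\<lambda>_. euclideanreal) (UC :: ('g \<Rightarrow> real) set)"
  have ev: "continuous_map ?P euclideanreal (\<lambda>\<phi>. \<phi> f)" if "f \<in> UC" for f
    using that by (rule continuous_map_product_projection)
  have eq: "closedin ?P {\<phi> \<in> topspace ?P. a \<phi> = b \<phi>}"
    if "continuous_map ?P euclideanreal a" "continuous_map ?P euclideanreal b" for a b
  proof -
    have "closedin ?P {\<phi> \<in> topspace ?P. a \<phi> - b \<phi> \<in> {0}}"
      by (rule closedin_continuous_map_preimage[of _ euclideanreal])
        (use that in \<open>auto intro!: continuous_intros\<close>)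
    then show ?thesis by simp
  qed
  obtain c where c: "\<And>f x. f \<in> (UC :: ('g \<Rightarrow> real) set) \<Longrightarrow> \<bar>f x\<bar> \<le> c f"
    using UC_bounded by metis
  have K: "compactin ?P (PiE UC (\<lambda>f. {- c f..c f}))" by (simp add: compactin_PiE)
  define T where "T = topspace (GUC :: (('g \<Rightarrow> real) \<Rightarrow> real) topology)"
  have T: "T = topspace ?P \<inter>
     (\<Inter>f\<in>UC. \<Inter>h\<in>UC. {\<phi> \<in> topspace ?P. \<phi> (\<lambda>x. f x + h x) = \<phi> f + \<phi> h}) \<inter>
     (\<Inter>c. \<Inter>f\<in>UC. {\<phi> \<in> topspace ?P. \<phi> (\<lambda>x. c * f x) = c * \<phi> f}) \<inter>
     (\<Inter>f\<in>UC. \<Inter>h\<in>UC. {\<phi> \<in> topspace ?P. \<phi> (\<lambda>x. f x * h x) = \<phi> f * \<phi> h}) \<inter>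
     {\<phi> \<in> topspace ?P. \<phi> (\<lambda>x. 1) = 1}"
    by (rule set_eqI) (auto simp: T_def topspace_GUC PiE_def)
  \<comment> \<open>An intersection over an empty index set would be the whole type, so
    \<open>closedin_INT\<close> asks for nonempty index sets.\<close>
  have ne: "UC \<noteq> {}" using UC_const by blast
  have add: "closedin ?P {\<phi> \<in> topspace ?P. \<phi> (\<lambda>x. f x + h x) = \<phi> f + \<phi> h}"
    and mult: "closedin ?P {\<phi> \<in> topspace ?P. \<phi> (\<lambda>x. f x * h x) = \<phi> f * \<phi> h}"
    and cmult: "closedin ?P {\<phi> \<in> topspace ?P. \<phi> (\<lambda>x. c * f x) = c * \<phi> f}"
    if "f \<in> UC" "h \<in> UC" for f h c
    by (rule eq; intro ev UC_add UC_mult UC_cmult continuous_map_add continuous_map_real_mult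
        continuous_map_real_mult_left that)+
  have one: "closedin ?P {\<phi> \<in> topspace ?P. \<phi> (\<lambda>x. 1) = 1}"
    by (rule eq) (simp_all add: ev UC_const)
  have "closedin ?P T"
    unfolding T using ne
    by (intro closedin_Int closedin_topspace closedin_INT add mult cmult one) simp_all
  moreover have "T \<subseteq> PiE UC (\<lambda>f. {- c f..c f})"
  proof (intro subsetI PiE_I)
    fix \<phi> and f :: "'g \<Rightarrow> real" assume *: "\<phi> \<in> T" "f \<in> UC"
    then have \<phi>: "\<phi> \<in> topspace GUC" by (simp add: T_def)
    \<comment> \<open>Comparison with the zero function, which \<open>\<phi>\<close> sends to 0,
      bounds \<open>\<phi> f\<close> itself.\<close>
    have "\<bar>\<phi> f - \<phi> (\<lambda>x. 0)\<bar> \<le> c f"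
      by (rule GUC_dist_le[OF \<phi> *(2) UC_const]) (simp add: c *(2))
    then show "\<phi> f \<in> {- c f..c f}" by (simp add: GUC_const \<phi> abs_le_iff minus_le_iff)
  next
    fix \<phi> and f :: "'g \<Rightarrow> real" assume "\<phi> \<in> T" "f \<notin> UC"
    then show "\<phi> f = undefined" using GUC_extensional[of \<phi>] by (simp add: T_def extensional_def)
  qed
  ultimately have "compactin ?P T" using closed_compactin[OF K] by blast
  moreover have "GUC = subtopology ?P T"
    unfolding T_def gelfand_space_def by (simp only: topspace_subtopology subtopology_restrict)
  ultimately show ?thesis by (simp add: compact_space_subtopology)
qed

section \<open>The canonical map and its dense image\<close>

lemma GUC_map_in: "GUC_map g \<in> topspace GUC"
  by (simp add: topspace_GUC GUC_map_def UC_add UC_mult UC_cmult UC_const)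

lemma continuous_GUC_map: "continuous_map euclidean GUC GUC_map"
  unfolding continuous_map_into_GUC by (simp add: GUC_map_in) (simp add: GUC_map_def UC_continuous)

lemma GUC_act_in:
  assumes "\<phi> \<in> topspace GUC"
  shows "GUC_act g \<phi> \<in> topspace GUC"
  using assms
  by (simp add: topspace_GUC GUC_act_def UC_add UC_mult UC_cmult UC_const UC_translate)

lemma GUC_act_map: "GUC_act g (GUC_map h) = GUC_map (g + h)"
  by (rule ext) (simp add: GUC_act_def GUC_map_def UC_translate)

text \<open>A point outside the closure of the image would be separated from this compact set by
  finitely many functions in \<open>UC\<close>, and these combine into a single function that
  contradicts monotonicity.\<close>

lemma GUC_dense: "GUC closure_of (range GUC_map) = topspace (GUC :: (('g::topological_group_add \<Rightarrow> real) \<Rightarrow> real) topology)"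
proof (rule ccontr)
  let ?C = "(GUC :: (('g \<Rightarrow> real) \<Rightarrow> real) topology) closure_of (range GUC_map)"
  assume "\<not> ?thesis"
  then obtain \<phi> where \<phi>: "\<phi> \<in> topspace GUC" "\<phi> \<notin> ?C"
    using closure_of_subset_topspace[of "GUC :: (('g \<Rightarrow> real) \<Rightarrow> real) topology" "range GUC_map"] by blast
  have CT: "\<psi> \<in> topspace GUC" if "\<psi> \<in> ?C" for \<psi>
    using that by (rule in_closure_of[THEN iffD1, THEN conjunct1])
  have C: "compactin GUC ?C"
    by (simp add: closedin_compact_space[OF compact_GUC])
  define U where "U f = {\<psi> \<in> topspace GUC. \<psi> f \<in> - {\<phi> f}}" for f :: "'g \<Rightarrow> real"
  have "openin GUC (U f)" if "f \<in> UC" for f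
    unfolding U_def
    by (rule openin_continuous_map_preimage[OF continuous_map_GUC_eval[OF that]]) auto
  moreover have "?C \<subseteq> \<Union>(U ` UC)"
  proof
    fix \<psi> assume "\<psi> \<in> ?C"
    then have \<psi>: "\<psi> \<in> topspace GUC" "\<psi> \<noteq> \<phi>" using \<phi>(2) CT by blast+
    then obtain f where "f \<in> UC" "\<psi> f \<noteq> \<phi> f" using GUC_eqI[OF \<psi>(1) \<phi>(1)] by blast
    then show "\<psi> \<in> \<Union>(U ` UC)" using \<psi>(1) by (auto simp: U_def)
  qed
  ultimately obtain \<F> where "finite \<F>" "\<F> \<subseteq> U ` UC" "?C \<subseteq> \<Union>\<F>"
    using compactinD[OF C, of "U ` UC"] by blast
  then obtain B where B: "finite B" "B \<subseteq> UC" "?C \<subseteq> \<Union>(U ` B)"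
    using finite_subset_image[of \<F> U UC] by blast
  \<comment> \<open>The sum \<open>Q\<close> of the squares \<open>q f\<close> is bounded below by a positive constant on \<open>G\<close>, but \<open>\<phi> Q = 0\<close>.\<close>
  define q where "q f x = (f x - \<phi> f) * (f x - \<phi> f)" for f and x :: 'g
  have q: "q f \<in> UC" if "f \<in> B" for f
    unfolding q_def using that B by (intro UC_mult UC_diff UC_const) auto
  have \<psi>q: "\<psi> (q f) = (\<psi> f - \<phi> f)\<^sup>2" if \<psi>: "\<psi> \<in> topspace GUC" and "f \<in> B" for \<psi> f
  proof -
    have f: "f \<in> UC" using that B by blast
    have "\<psi> (q f) = \<psi> (\<lambda>x. f x - \<phi> f) * \<psi> (\<lambda>x. f x - \<phi> f)"
      unfolding q_def by (intro GUC_mult \<psi> UC_diff f UC_const)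
    also have "\<psi> (\<lambda>x. f x - \<phi> f) = \<psi> f - \<phi> f"
      by (simp only: GUC_diff[OF \<psi> f UC_const] GUC_const[OF \<psi>])
    finally show ?thesis by (simp add: power2_eq_square)
  qed
  define Q where "Q x = (\<Sum>f\<in>B. q f x)" for x
  have Q: "Q \<in> UC" unfolding Q_def using q by (rule UC_sum)
  have \<psi>Q: "\<psi> Q = (\<Sum>f\<in>B. (\<psi> f - \<phi> f)\<^sup>2)" if "\<psi> \<in> topspace GUC" for \<psi>
    unfolding Q_def using that q by (simp add: GUC_sum \<psi>q)
  have pos: "\<psi> Q > 0" if \<psi>: "\<psi> \<in> ?C" for \<psi>
  proof -
    obtain f where f: "f \<in> B" "\<psi> f \<noteq> \<phi> f" using B(3) \<psi> by (auto simp: U_def)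
    have "(\<Sum>f\<in>B. (\<psi> f - \<phi> f)\<^sup>2) > 0"
      by (rule sum_pos2[OF B(1) f(1)]) (use f(2) in simp_all)
    then show ?thesis by (simp add: \<psi>Q CT[OF \<psi>])
  qed
  have "compact ((\<lambda>\<psi>. \<psi> Q) ` ?C)"
    using image_compactin[OF C continuous_map_GUC_eval[OF Q]] by simp
  moreover have iC: "GUC_map g \<in> ?C" for g
    using closure_of_subset[of "range GUC_map" GUC] GUC_map_in by blast
  \<comment> \<open>Evaluation at \<open>Q\<close> attains its minimum on the compact closure, and
    this minimum is positive by \<open>pos\<close>. It bounds \<open>Q\<close> from below on the
    group, so \<open>GUC_mono\<close> carries it over to \<open>\<phi> Q\<close>.\<close>
  ultimately obtain \<psi> where \<psi>: "\<psi> \<in> ?C" "\<forall>\<theta>\<in>?C. \<psi> Q \<le> \<theta> Q"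
    using compact_attains_inf[of "(\<lambda>\<psi>. \<psi> Q) ` ?C"] by blast
  have "\<psi> Q \<le> Q g" for g
    using bspec[OF \<psi>(2) iC, of g] Q by (simp add: GUC_map_def)
  then have "\<psi> Q \<le> \<phi> Q"
    using GUC_mono[OF \<phi>(1) UC_const Q] by (simp add: GUC_const \<phi>(1))
  then show False using pos[OF \<psi>(1)] by (simp add: \<psi>Q[OF \<phi>(1)])
qed

section \<open>Continuity of the action on the Gelfand space\<close>

lemma compact_Hausdorff_completely_regular:
  "\<lbrakk>compact_space X; Hausdorff_space X\<rbrakk> \<Longrightarrow> completely_regular_space X"
  by (simp add: compact_Hausdorff_or_regular_imp_normal_space normal_imp_completely_regular_space)

lemma continuous_map_real_iff:
  "continuous_map X euclideanreal f \<longleftrightarrow>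
     (\<forall>x\<in>topspace X. \<forall>\<epsilon>>0. \<exists>U. openin X U \<and> x \<in> U \<and> (\<forall>y\<in>U. \<bar>f y - f x\<bar> < \<epsilon>))"
  using Met_TC.continuous_map_to_metric[of X f]
  by (simp add: dist_real_def abs_minus_commute)

text \<open>Joint continuity splits in two. Replacing \<open>a\<close> by \<open>g\<close> changes
  the function \<open>f (a + h)\<close> little, uniformly in \<open>h\<close>, hence changes every
  functional's value little; replacing \<open>\<psi>\<close> by \<open>\<phi>\<close> is then
  continuity of evaluation at one fixed function.\<close>

lemma continuous_GUC_act:
  "continuous_map (prod_topology euclidean GUC) GUC (\<lambda>(g, \<phi>). GUC_act g \<phi>)"
  unfolding continuous_map_into_GUC
proof (intro conjI ballI)
  fix f :: "'a \<Rightarrow> real" assume f: "f \<in> UC"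
  have "continuous_map (prod_topology euclidean GUC) euclideanreal (\<lambda>p. snd p (\<lambda>h. f (fst p + h)))"
    unfolding continuous_map_real_iff
  proof (intro ballI allI impI)
    fix p :: "'a \<times> (('a \<Rightarrow> real) \<Rightarrow> real)" and \<epsilon> :: real
    assume "p \<in> topspace (prod_topology euclidean GUC)" and e: "\<epsilon> > 0"
    then obtain g \<phi> where p: "p = (g, \<phi>)" "\<phi> \<in> topspace GUC" by auto
    obtain V where V: "open V" "0 \<in> V" "\<And>v h. v \<in> V \<Longrightarrow> \<bar>f (v + h) - f h\<bar> < \<epsilon> / 2"
      using UC_eventually(1)[OF f half_gt_zero[OF e]] unfolding eventually_nhds by blast
    \<comment> \<open>For \<open>a\<close> in \<open>A\<close>,
      \<open>a + h = (a - g) + (g + h)\<close> with \<open>a - g\<close> in \<open>V\<close>, so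
      left uniform continuity applies at \<open>g + h\<close>.\<close>
    define A where "A = {a. a - g \<in> V}"
    have "A = (\<lambda>a. a - g) -` V" by (auto simp: A_def)
    moreover have "continuous_on UNIV (\<lambda>a. a - g)" by (intro continuous_intros)
    ultimately have A: "open A" using V(1) by (simp add: open_vimage)
    define k where "k h = f (g + h)" for h
    have k_eq: "(\<lambda>h. f (g + h)) = k" by (simp add: k_def fun_eq_iff)
    have k: "k \<in> UC" unfolding k_def using f by (rule UC_translate)
    define B where "B = {\<psi> \<in> topspace GUC. \<psi> k \<in> ball (\<phi> k) (\<epsilon> / 2)}"
    have B: "openin GUC B" unfolding B_def
      by (rule openin_continuous_map_preimage[OF continuous_map_GUC_eval[OF k]]) simp
    have "\<bar>\<psi> (\<lambda>h. f (a + h)) - \<phi> k\<bar> < \<epsilon>" if "a \<in> A" "\<psi> \<in> B" for a \<psi>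
    proof -
      have fk: "\<bar>f (a + h) - k h\<bar> \<le> \<epsilon> / 2" for h
        using V(3)[of "a - g" "g + h"] that(1)
        by (simp add: A_def k_def add.assoc[symmetric] less_imp_le)
      have "\<psi> \<in> topspace GUC" using that(2) by (simp add: B_def)
      then have "\<bar>\<psi> (\<lambda>h. f (a + h)) - \<psi> k\<bar> \<le> \<epsilon> / 2"
        using UC_translate[OF f] k fk by (rule GUC_dist_le)
      moreover have "\<bar>\<psi> k - \<phi> k\<bar> < \<epsilon> / 2" using that(2) by (simp add: B_def dist_real_def abs_minus_commute)
      ultimately show ?thesis by linarith
    qed
    moreover have "openin (prod_topology euclidean GUC) (A \<times> B)"
      using A B by (simp add: openin_prod_Times_iff)
    moreover have "p \<in> A \<times> B" using V(2) e by (simp add: p A_def B_def)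
    ultimately show "\<exists>U. openin (prod_topology euclidean GUC) U \<and> p \<in> U \<and>
        (\<forall>q\<in>U. \<bar>snd q (\<lambda>h. f (fst q + h)) - snd p (\<lambda>h. f (fst p + h))\<bar> < \<epsilon>)"
      by (intro exI[of _ "A \<times> B"]) (auto simp: p k_eq)
  qed
  then show "continuous_map (prod_topology euclidean GUC) euclideanreal (\<lambda>p. (case p of (g, \<phi>) \<Rightarrow> GUC_act g \<phi>) f)"
    using f by (simp add: GUC_act_def case_prod_unfold)
qed (auto simp: GUC_act_in)

lemma compact_G_space_GUC: "compact_G_space GUC GUC_act"
proof -
  have "GUC_act 0 \<phi> = \<phi>" if \<phi>: "\<phi> \<in> topspace GUC" for \<phi> :: "('a \<Rightarrow> real) \<Rightarrow> real"
    by (rule GUC_eqI[OF GUC_act_in[OF \<phi>] \<phi>]) (simp add: GUC_act_def)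
  moreover have "GUC_act (g + h) \<phi> = GUC_act g (GUC_act h \<phi>)" for g h and \<phi> :: "('a \<Rightarrow> real) \<Rightarrow> real"
    by (rule ext) (simp add: GUC_act_def UC_translate add.assoc)
  moreover note compact_Hausdorff_completely_regular[OF compact_GUC Hausdorff_GUC]
  ultimately show ?thesis
    unfolding compact_G_space_def G_space_def
    by (intro conjI ballI allI compact_GUC Hausdorff_GUC continuous_GUC_act) simp_all
qed

lemma dense_G_map_GUC: "dense_G_map GUC GUC_act GUC_map"
  by (simp add: dense_G_map_def G_map_def continuous_GUC_map GUC_act_map GUC_dense)

text \<open>Continuous maps into a Hausdorff space are determined on the dense image of the group;
  this is the uniqueness behind associativity.\<close>

lemma GUC_map_agree:
  assumes "continuous_map GUC Y a" "continuous_map GUC Y b" "Hausdorff_space Y"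
    and "\<And>g. a (GUC_map g) = b (GUC_map g)" and "s \<in> topspace GUC"
  shows "a s = b s"
proof (rule forall_in_closure_of_eq[where f = a and g = b])
  show "s \<in> GUC closure_of (range GUC_map)" using assms(5) by (simp add: GUC_dense)
qed (use assms in auto)

section \<open>SUC spaces\<close>

lemma compact_G_spaceD:
  assumes "compact_G_space Y act"
  shows "compact_space Y" "Hausdorff_space Y"
    and "continuous_map (prod_topology euclidean Y) Y (\<lambda>(g, x). act g x)"
    and "x \<in> topspace Y \<Longrightarrow> act 0 x = x"
    and "x \<in> topspace Y \<Longrightarrow> act (g + h) x = act g (act h x)"
    and "x \<in> topspace Y \<Longrightarrow> act g x \<in> topspace Y"
    and "continuous_map Y Y (act g)"
proof -
  show "compact_space Y" "Hausdorff_space Y"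
    and c: "continuous_map (prod_topology euclidean Y) Y (\<lambda>(g, x). act g x)"
    using assms by (simp_all add: compact_G_space_def G_space_def)
  show "x \<in> topspace Y \<Longrightarrow> act 0 x = x"
    using assms by (simp add: compact_G_space_def G_space_def)
  show "x \<in> topspace Y \<Longrightarrow> act (g + h) x = act g (act h x)"
    using assms by (simp add: compact_G_space_def G_space_def)
  show "x \<in> topspace Y \<Longrightarrow> act g x \<in> topspace Y"
    using funcset_mem[OF continuous_map_funspace[OF c], of "(g, x)"] by simp
  have "continuous_map Y (prod_topology euclidean Y) (\<lambda>x. (g, x))"
    by (simp add: continuous_map_pairedI)
  from continuous_map_compose[OF this c] show "continuous_map Y Y (act g)"
    by (simp add: o_def)
qed

text \<open>The difference is jointly continuous and vanishes on
  \<open>{0} \<times> topspace Y\<close>; since \<open>Y\<close> is compact, the tube lemma provides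
  one neighborhood of the neutral element for all \<open>y\<close>.\<close>

lemma compact_G_space_uniformly_close:
  assumes Y: "compact_G_space Y act" and F: "continuous_map Y euclideanreal F" and e: "\<epsilon> > 0"
  shows "\<forall>\<^sub>F v in nhds 0. \<forall>y\<in>topspace Y. \<bar>F (act v y) - F y\<bar> < \<epsilon>"
proof -
  note D = compact_G_spaceD[OF Y]
  let ?P = "prod_topology euclidean Y"
  have c: "continuous_map ?P euclideanreal (\<lambda>p. F ((\<lambda>(g, x). act g x) p) - F (snd p))"
    using continuous_map_compose[OF D(3) F] continuous_map_compose[OF continuous_map_snd[of euclidean Y] F]
    by (intro continuous_map_diff) (simp_all add: o_def)
  define W where "W = {p \<in> topspace ?P. F ((\<lambda>(g, x). act g x) p) - F (snd p) \<in> ball 0 \<epsilon>}"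
  have "openin ?P W"
    unfolding W_def by (rule openin_continuous_map_preimage[OF c]) simp
  moreover have "compactin Y (topspace Y)" using D(1) by (simp add: compact_space_def)
  moreover have "{0} \<times> topspace Y \<subseteq> W" using e by (auto simp: W_def D(4))
  ultimately obtain U V where "open U" "0 \<in> U" "topspace Y \<subseteq> V" "U \<times> V \<subseteq> W"
    using tube_lemma_right[of euclidean Y W "topspace Y" 0] by auto
  moreover have "\<bar>F (act v y) - F y\<bar> < \<epsilon>" if "(v, y) \<in> W" for v y
    using that by (simp add: W_def dist_real_def abs_minus_commute)
  ultimately show ?thesis unfolding eventually_nhds by (intro exI[of _ U]) blast
qed

text \<open>The two halves of uniform continuity have different sources: small left translations are
  controlled by compactness of \<open>Y\<close>, small right translations by the SUC property at
  \<open>y\<close>.\<close>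

lemma orbit_function_in_UC:
  assumes Y: "SUC_space Y act" and F: "continuous_map Y euclideanreal F" and y: "y \<in> topspace Y"
  shows "(\<lambda>h. F (act h y)) \<in> UC"
proof -
  have cY: "compact_G_space Y act" using Y by (simp add: SUC_space_def)
  note D = compact_G_spaceD[OF cY]
  have "compact (F ` topspace Y)"
    using image_compactin[OF _ F] D(1) by (simp add: compact_space_def)
  then have "bounded (range (\<lambda>h. F (act h y)))"
    by (rule bounded_subset[OF compact_imp_bounded]) (use D(6) y in auto)
  moreover have "\<forall>\<^sub>F v in nhds 0. \<forall>g. \<bar>F (act (v + g) y) - F (act g y)\<bar> < \<epsilon> \<and>
      \<bar>F (act (g + v) y) - F (act g y)\<bar> < \<epsilon>" if e: "\<epsilon> > 0" for \<epsilon>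
  proof -
    \<comment> \<open>An open neighborhood of the diagonal, hence an entourage to which the SUC
      property applies.\<close>
    define E where "E = {p \<in> topspace (prod_topology Y Y). F (fst p) - F (snd p) \<in> ball 0 \<epsilon>}"
    have "continuous_map (prod_topology Y Y) euclideanreal (\<lambda>p. F (fst p) - F (snd p))"
      using continuous_map_compose[OF continuous_map_fst[of Y Y] F]
        continuous_map_compose[OF continuous_map_snd[of Y Y] F]
      by (intro continuous_map_diff) (simp_all add: o_def)
    then have "openin (prod_topology Y Y) E"
      unfolding E_def by (rule openin_continuous_map_preimage) simp
    moreover have "Id_on (topspace Y) \<subseteq> E" using e by (auto simp: E_def)
    ultimately have "E \<in> the_uniformity Y"
      unfolding the_uniformity_eq[OF D(1,2)] by (auto simp: E_def)
    then have "\<forall>\<^sub>F u in nhds 0. \<forall>g. (act (g + u) y, act g y) \<in> E"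
      using Y y by (simp add: SUC_space_def)
    with compact_G_space_uniformly_close[OF cY F e] show ?thesis
    proof eventually_elim
      case (elim v)
      have "\<bar>F (act (v + g) y) - F (act g y)\<bar> < \<epsilon>" for g
        using bspec[OF elim(1) D(6)[OF y, of g]] by (simp add: D(5)[OF y])
      moreover have "\<bar>F (act (g + v) y) - F (act g y)\<bar> < \<epsilon>" for g
        using spec[OF elim(2), of g] by (simp add: E_def dist_real_def abs_minus_commute)
      ultimately show ?case by blast
    qed
  qed
  ultimately show ?thesis by (simp add: UC_iff)
qed

section \<open>Functions in SUC(G) and their matrix coefficients\<close>

lemma SUC_cases:
  fixes f :: "'g::topological_group_add \<Rightarrow> real"
  assumes "f \<in> SUC"
  obtains Y :: "(('g \<Rightarrow> real) \<Rightarrow> real) topology" and act \<nu> F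
  where "SUC_space Y act" "continuous_map Y euclideanreal F" "continuous_map euclidean Y \<nu>"
    "\<And>g. \<nu> g \<in> topspace Y" "\<And>g h. \<nu> (g + h) = act g (\<nu> h)" "\<And>g. f g = F (\<nu> g)"
proof -
  obtain Y :: "(('g \<Rightarrow> real) \<Rightarrow> real) topology" and act \<nu> F
    where *: "SUC_space Y act" "dense_G_map Y act \<nu>" "continuous_map Y euclideanreal F" "f = F \<circ> \<nu>"
    using assms unfolding SUC_def by blast
  have c: "continuous_map euclidean Y \<nu>" and eq: "\<And>g h. \<nu> (g + h) = act g (\<nu> h)"
    using *(2) by (simp_all add: dense_G_map_def G_map_def)
  have "\<nu> g \<in> topspace Y" for g
    using funcset_mem[OF continuous_map_funspace[OF c], of g] by simp
  then show thesis using that[OF *(1,3) c _ eq] *(4) by simp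
qed

text \<open>A function \<open>F \<circ> \<nu>\<close> is the orbit function of the point
  \<open>\<nu> 0\<close>.\<close>

lemma SUC_subset_UC: "SUC \<subseteq> UC"
proof
  fix f :: "'a \<Rightarrow> real" assume "f \<in> SUC"
  then obtain Y :: "(('a \<Rightarrow> real) \<Rightarrow> real) topology" and act \<nu> F
    where Y: "SUC_space Y act" "continuous_map Y euclideanreal F" "continuous_map euclidean Y \<nu>"
    "\<And>g. \<nu> g \<in> topspace Y" "\<And>g h. \<nu> (g + h) = act g (\<nu> h)" "\<And>g. f g = F (\<nu> g)"
    by (rule SUC_cases) blast
  have "\<nu> h = act h (\<nu> 0)" for h using Y(5)[of h 0] by simp
  then have "f = (\<lambda>h. F (act h (\<nu> 0)))" by (intro ext) (metis Y(6))
  then show "f \<in> UC" using orbit_function_in_UC[OF Y(1,2,4)] by simp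
qed

text \<open>
  A limit \<open>p\<close> of points of \<open>i(G)\<close> lifts to a point \<open>(p, y)\<close> in the closure of
  \<open>{(i(g), \<nu>(g)). g \<in> G}\<close>, and then the matrix coefficient of \<open>p\<close> is the orbit function of \<open>y\<close>.
\<close>

lemma SUC_coefficient_in_UC:
  fixes f :: "'g::topological_group_add \<Rightarrow> real"
  assumes f: "f \<in> SUC" and p: "p \<in> topspace GUC"
  shows "(\<lambda>h. p (\<lambda>x. f (h + x))) \<in> UC"
proof -
  obtain Y :: "(('g \<Rightarrow> real) \<Rightarrow> real) topology" and act \<nu> F
    where Y: "SUC_space Y act" "continuous_map Y euclideanreal F" "continuous_map euclidean Y \<nu>"
    "\<And>g. \<nu> g \<in> topspace Y" "\<And>g h. \<nu> (g + h) = act g (\<nu> h)" "\<And>g. f g = F (\<nu> g)"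
    using f by (rule SUC_cases) blast
  have fUC: "f \<in> UC" using f SUC_subset_UC by blast
  have "compact_G_space Y act" using Y(1) by (simp add: SUC_space_def)
  note D = compact_G_spaceD[OF this]
  define P where "P = prod_topology (GUC :: (('g \<Rightarrow> real) \<Rightarrow> real) topology) Y"
  have cP: "compact_space P" unfolding P_def by (simp add: compact_space_prod_topology compact_GUC D(1))
  define C where "C = P closure_of (range (\<lambda>g. (GUC_map g, \<nu> g)))"
  have "compactin P C" unfolding C_def by (simp add: closedin_compact_space[OF cP])
  \<comment> \<open>The projection of the compact set \<open>C\<close> is closed and contains the
    dense image of the group, so it is all of \<open>GUC\<close> and \<open>p\<close> has a partner
    \<open>y\<close>.\<close>
  then have "compactin GUC (fst ` C)"
    by (rule image_compactin) (simp add: P_def continuous_map_fst)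
  then have "closedin GUC (fst ` C)" by (rule compactin_imp_closedin[OF Hausdorff_GUC])
  moreover have "(GUC_map g, \<nu> g) \<in> C" for g
    using closure_of_subset[of "range (\<lambda>g. (GUC_map g, \<nu> g))" P] Y(4) GUC_map_in
    unfolding C_def P_def by auto
  then have "range GUC_map \<subseteq> fst ` C" by force
  ultimately have "GUC closure_of (range GUC_map) \<subseteq> fst ` C" by (rule closure_of_minimal[rotated])
  then obtain y where py: "(p, y) \<in> C" using p unfolding GUC_dense by force
  then have "(p, y) \<in> topspace P" unfolding C_def by (rule in_closure_of[THEN iffD1, THEN conjunct1])
  then have y: "y \<in> topspace Y" by (simp add: P_def)
  have "p (\<lambda>x. f (h + x)) = F (act h y)" for h
  proof -
    \<comment> \<open>Both sides are made continuous functions on \<open>P\<close>; they agree at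
      the points \<open>(GUC_map g, \<nu> g)\<close>, hence on the closure \<open>C\<close>.\<close>
    have "continuous_map P euclideanreal ((\<lambda>\<phi>. \<phi> (\<lambda>x. f (h + x))) \<circ> fst)"
      unfolding P_def
      by (rule continuous_map_compose[OF continuous_map_fst continuous_map_GUC_eval[OF UC_translate[OF fUC]]])
    moreover have "continuous_map P euclideanreal ((F \<circ> act h) \<circ> snd)"
      unfolding P_def
      by (rule continuous_map_compose[OF continuous_map_snd continuous_map_compose[OF D(7) Y(2)]])
    moreover have "((\<lambda>\<phi>. \<phi> (\<lambda>x. f (h + x))) \<circ> fst) q = ((F \<circ> act h) \<circ> snd) q"
      if "q \<in> range (\<lambda>g. (GUC_map g, \<nu> g))" for q
    proof -
      obtain g where "q = (GUC_map g, \<nu> g)" using \<open>q \<in> _\<close> by blast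
      then have "((\<lambda>\<phi>. \<phi> (\<lambda>x. f (h + x))) \<circ> fst) q = f (h + g)"
        using UC_translate[OF fUC] by (simp add: GUC_map_def)
      then show ?thesis using \<open>q = _\<close> by (simp add: Y(5,6))
    qed
    ultimately have "((\<lambda>\<phi>. \<phi> (\<lambda>x. f (h + x))) \<circ> fst) (p, y) = ((F \<circ> act h) \<circ> snd) (p, y)"
      using forall_in_closure_of_eq[OF py[unfolded C_def] Hausdorff_space_euclidean] by blast
    then show ?thesis by simp
  qed
  then show ?thesis using orbit_function_in_UC[OF Y(1,2) y] by simp
qed

section \<open>The equivalences\<close>

lemma G_map_GUC_orbit:
  assumes "G_map GUC GUC_act GUC GUC_act \<phi>"
  shows "\<phi> (GUC_map g) = GUC_act g (\<phi> (GUC_map 0))"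
proof -
  have "\<phi> (GUC_act g (GUC_map 0)) = GUC_act g (\<phi> (GUC_map 0))"
    using assms GUC_map_in unfolding G_map_def by blast
  then show ?thesis by (simp add: GUC_act_map)
qed

text \<open>The target may be enlarged from the orbit closure to all of \<open>GUC\<close>: a G-map
  sending \<open>GUC_map 0\<close> to \<open>x\<close> sends the dense orbit onto the orbit of
  \<open>x\<close>, so by continuity its image lies in the closure.\<close>

lemma point_universal_GUC_iff:
  "point_universal GUC GUC_act (GUC_map (0::'g::topological_group_add)) \<longleftrightarrow>
     (\<forall>x\<in>topspace GUC. \<exists>\<phi>. G_map GUC GUC_act GUC GUC_act \<phi> \<and> \<phi> (GUC_map (0::'g)) = x)"
proof -
  have im: "\<phi> ` topspace GUC \<subseteq> GUC closure_of (range (\<lambda>g. GUC_act g x))"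
    if \<phi>: "G_map GUC GUC_act GUC GUC_act \<phi>" "\<phi> (GUC_map 0) = x" for \<phi> and x :: "('g \<Rightarrow> real) \<Rightarrow> real"
  proof -
    have "\<phi> (GUC_map g) = GUC_act g x" for g
      using G_map_GUC_orbit[OF \<phi>(1)] \<phi>(2) by simp
    then have "\<phi> ` range GUC_map = range (\<lambda>g. GUC_act g x)" by (simp add: image_image)
    moreover have "continuous_map GUC GUC \<phi>" using \<phi>(1) by (simp add: G_map_def)
    ultimately show ?thesis
      using continuous_map_image_closure_subset[of GUC GUC \<phi> "range GUC_map"] by (simp add: GUC_dense)
  qed
  have "G_map GUC GUC_act (subtopology GUC (GUC closure_of (range (\<lambda>g. GUC_act g x)))) GUC_act \<phi> \<and> \<phi> (GUC_map 0) = x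
      \<longleftrightarrow> G_map GUC GUC_act GUC GUC_act \<phi> \<and> \<phi> (GUC_map 0) = x" for \<phi> and x :: "('g \<Rightarrow> real) \<Rightarrow> real"
  proof (intro iffI conjI; elim conjE)
    assume "G_map GUC GUC_act GUC GUC_act \<phi>" "\<phi> (GUC_map 0) = x"
    from im[OF this] this(1)
    show "G_map GUC GUC_act (subtopology GUC (GUC closure_of (range (\<lambda>g. GUC_act g x)))) GUC_act \<phi>"
      by (simp add: G_map_def continuous_map_in_subtopology image_subset_iff_funcset)
  qed (simp_all add: G_map_def continuous_map_in_subtopology)
  then show ?thesis
    by (simp add: point_universal_def compact_G_space_GUC GUC_map_in GUC_act_map GUC_dense)
qed

lemma semigroup_iff_point_universal:
  "(\<exists>m. right_top_semigroup_compactification GUC GUC_act m (GUC_map :: 'a::topological_group_add \<Rightarrow> _)) \<longleftrightarrow>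
     point_universal GUC GUC_act (GUC_map (0::'a))"
  unfolding point_universal_GUC_iff
proof (intro iffI ballI)
  fix p :: "('a \<Rightarrow> real) \<Rightarrow> real"
  assume "\<exists>m. right_top_semigroup_compactification GUC GUC_act m (GUC_map :: 'a \<Rightarrow> _)" and p: "p \<in> topspace GUC"
  then obtain m where m: "right_top_semigroup_compactification GUC GUC_act m (GUC_map :: 'a \<Rightarrow> _)" by blast
  \<comment> \<open>Since \<open>GUC_act g\<close> is left multiplication by
    \<open>GUC_map g\<close>, equivariance of \<open>s \<mapsto> m s p\<close> is
    associativity.\<close>
  have "G_map GUC GUC_act GUC GUC_act (\<lambda>s. m s p)"
    using m p by (simp add: right_top_semigroup_compactification_def G_map_def GUC_map_in)
  moreover have "m (GUC_map 0) p = p"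
  proof -
    have "m (GUC_map 0) p = GUC_act 0 p"
      using m p by (simp add: right_top_semigroup_compactification_def)
    then show ?thesis using compact_G_spaceD(4)[OF compact_G_space_GUC p] by simp
  qed
  ultimately show "\<exists>\<phi>. G_map GUC GUC_act GUC GUC_act \<phi> \<and> \<phi> (GUC_map 0) = p" by blast
next
  assume "\<forall>x\<in>topspace GUC. \<exists>\<phi>. G_map GUC GUC_act GUC GUC_act \<phi> \<and> \<phi> (GUC_map (0::'a)) = x"
  then obtain R where R: "\<And>x. x \<in> topspace GUC \<Longrightarrow> G_map GUC GUC_act GUC GUC_act (R x) \<and> R x (GUC_map (0::'a)) = x"
    by metis
  have cR: "continuous_map GUC GUC (R x)" and aR: "\<And>g s. s \<in> topspace GUC \<Longrightarrow> R x (GUC_act g s) = GUC_act g (R x s)"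
    and R0: "R x (GUC_map 0) = x" if "x \<in> topspace GUC" for x
    using R[OF that] by (simp_all add: G_map_def)
  have RT: "R x s \<in> topspace GUC" if "x \<in> topspace GUC" "s \<in> topspace GUC" for x s
    using funcset_mem[OF continuous_map_funspace[OF cR]] that by blast
  have Rg: "R x (GUC_map g) = GUC_act g x" if "x \<in> topspace GUC" for x g
    using aR[OF that GUC_map_in, of g 0] R0[OF that] by (simp add: GUC_act_map)
  \<comment> \<open>Both sides are continuous in \<open>s\<close>, and at
    \<open>s = GUC_map g\<close> both equal \<open>GUC_act g (R p t)\<close>. For the product
    \<open>R p s\<close> of \<open>s\<close> and \<open>p\<close> this is the associative
    law.\<close>
  have "R p (R t s) = R (R p t) s" if "s \<in> topspace GUC" "t \<in> topspace GUC" "p \<in> topspace GUC" for s t p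
  proof -
    have "(R p \<circ> R t) s = R (R p t) s"
      by (rule GUC_map_agree[OF continuous_map_compose[OF cR cR] cR Hausdorff_GUC _ that(1)])
        (simp_all add: that RT Rg aR)
    then show ?thesis by simp
  qed
  then have "right_top_semigroup_compactification GUC GUC_act (\<lambda>s p. R p s) GUC_map"
    unfolding right_top_semigroup_compactification_def
    by (simp add: compact_G_space_GUC dense_G_map_GUC RT cR Rg GUC_map_in GUC_act_map)
  then show "\<exists>m. right_top_semigroup_compactification GUC GUC_act m (GUC_map :: 'a \<Rightarrow> _)" by blast
qed

section \<open>From point-universality to the SUC property\<close>

text \<open>This is the SUC property at \<open>GUC_map 0\<close>. Two points whose pair lies outside
  \<open>W\<close> are separated with a definite gap by some function in \<open>UC\<close>;
  compactness of the complement leaves finitely many such functions, and their right uniform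
  continuity excludes all the pairs in question.\<close>

lemma GUC_map_right_uniform:
  assumes W: "openin (prod_topology GUC GUC) W" and d: "\<And>s. s \<in> topspace GUC \<Longrightarrow> (s, s) \<in> W"
  shows "\<forall>\<^sub>F u in nhds 0. \<forall>g. (GUC_map (g + u), GUC_map g) \<in> W"
proof -
  let ?P = "prod_topology GUC GUC :: ((('a \<Rightarrow> real) \<Rightarrow> real) \<times> (('a \<Rightarrow> real) \<Rightarrow> real)) topology"
  define U where "U = (\<lambda>(f :: 'a \<Rightarrow> real, e). {q \<in> topspace ?P. fst q f - snd q f \<in> - cball 0 e})"
  define I where "I = (UC :: ('a \<Rightarrow> real) set) \<times> {0::real<..}"
  have "openin ?P V" if V: "V \<in> U ` I" for V
  proof -
    obtain f e where f: "f \<in> UC" "V = U (f, e)" using V unfolding I_def by blast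
    have "continuous_map ?P euclideanreal (\<lambda>q. fst q f - snd q f)"
      using continuous_map_compose[OF continuous_map_fst continuous_map_GUC_eval[OF f(1)]]
        continuous_map_compose[OF continuous_map_snd continuous_map_GUC_eval[OF f(1)]]
      by (intro continuous_map_diff) (simp_all add: o_def)
    then show ?thesis
      unfolding f U_def split by (rule openin_continuous_map_preimage) (simp add: open_Compl)
  qed
  moreover have "compactin ?P (topspace ?P - W)"
  proof (rule closedin_compact_space)
    show "compact_space ?P" by (simp add: compact_space_prod_topology compact_GUC)
    show "closedin ?P (topspace ?P - W)" using W by (rule closedin_diff[OF closedin_topspace])
  qed
  moreover have "topspace ?P - W \<subseteq> \<Union>(U ` I)"
  proof
    fix q assume q: "q \<in> topspace ?P - W"
    obtain s t where st: "q = (s, t)" by (cases q)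
    then have sT: "s \<in> topspace GUC" "t \<in> topspace GUC" "s \<noteq> t" using q d by auto
    then obtain f where f: "f \<in> UC" "s f \<noteq> t f" using GUC_eqI[OF sT(1,2)] by blast
    \<comment> \<open>Half of the gap serves as radius, since \<open>U\<close> asks for a distance
      strictly beyond it.\<close>
    then have "q \<in> U (f, \<bar>s f - t f\<bar> / 2)" "(f, \<bar>s f - t f\<bar> / 2) \<in> I"
      using sT by (simp_all add: U_def I_def st)
    then show "q \<in> \<Union>(U ` I)" by blast
  qed
  ultimately have "\<exists>\<F>. finite \<F> \<and> \<F> \<subseteq> U ` I \<and> topspace ?P - W \<subseteq> \<Union>\<F>"
    by (intro compactinD)
  then obtain B where B: "finite B" "B \<subseteq> I" "topspace ?P - W \<subseteq> \<Union>(U ` B)"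
    by (auto dest: finite_subset_image)
  have "\<forall>\<^sub>F u in nhds 0. \<forall>g. \<bar>fst b (g + u) - fst b g\<bar> < snd b" if "b \<in> B" for b
    using B(2) that by (intro UC_eventually(2)) (auto simp: I_def)
  then have "\<forall>\<^sub>F u in nhds 0. \<forall>b\<in>B. \<forall>g. \<bar>fst b (g + u) - fst b g\<bar> < snd b"
    by (intro eventually_ball_finite B(1)) blast
  then show ?thesis
  proof (rule eventually_mono, intro allI)
    fix u g assume u: "\<forall>b\<in>B. \<forall>g. \<bar>fst b (g + u) - fst b g\<bar> < snd b"
    show "(GUC_map (g + u), GUC_map g) \<in> W"
    proof (rule ccontr)
      assume "(GUC_map (g + u), GUC_map g) \<notin> W"
      then have "(GUC_map (g + u), GUC_map g) \<in> topspace ?P - W" by (simp add: GUC_map_in)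
      then obtain f e where fe: "(f, e) \<in> B" "(GUC_map (g + u), GUC_map g) \<in> U (f, e)" using B(3) by force
      then have "f \<in> UC" using B(2) by (auto simp: I_def)
      then have "e < \<bar>f (g + u) - f g\<bar>" using fe(2) by (simp add: U_def GUC_map_def not_le)
      then show False using spec[OF bspec[OF u fe(1)], of g] by simp
    qed
  qed
qed

text \<open>The G-map \<open>\<phi>\<close> through \<open>y\<close> sends \<open>GUC_map g\<close>
  to \<open>GUC_act g y\<close>, so the preimage of \<open>W\<close> under
  \<open>\<phi> \<times> \<phi>\<close> reduces the claim at \<open>y\<close> to the one for the
  canonical map.\<close>

lemma point_universal_imp_SUC_space:
  assumes "point_universal GUC GUC_act (GUC_map (0::'g::topological_group_add))"
  shows "SUC_space GUC (GUC_act :: 'g \<Rightarrow> _)"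
  unfolding SUC_space_def
proof (intro conjI ballI compact_G_space_GUC)
  fix y :: "('g \<Rightarrow> real) \<Rightarrow> real" and E :: "((('g \<Rightarrow> real) \<Rightarrow> real) \<times> (('g \<Rightarrow> real) \<Rightarrow> real)) set"
  assume y: "y \<in> topspace GUC" and E: "E \<in> the_uniformity GUC"
  obtain W where W: "openin (prod_topology GUC GUC) W" "Id_on (topspace GUC) \<subseteq> W" "W \<subseteq> E"
    using E unfolding the_uniformity_eq[OF compact_GUC Hausdorff_GUC] by blast
  obtain \<phi> where \<phi>: "G_map GUC GUC_act GUC GUC_act \<phi>" "\<phi> (GUC_map 0) = y"
    using assms y unfolding point_universal_GUC_iff by blast
  have c: "continuous_map GUC GUC \<phi>" using \<phi>(1) by (simp add: G_map_def)
  have \<phi>g: "\<phi> (GUC_map g) = GUC_act g y" for g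
    using G_map_GUC_orbit[OF \<phi>(1)] \<phi>(2) by simp
  define W' where "W' = {q \<in> topspace (prod_topology GUC GUC). ((\<phi> \<circ> fst) q, (\<phi> \<circ> snd) q) \<in> W}"
  have "openin (prod_topology GUC GUC) W'"
    unfolding W'_def
    by (rule openin_continuous_map_preimage[OF continuous_map_pairedI W(1)])
      (rule continuous_map_compose[OF continuous_map_fst c] continuous_map_compose[OF continuous_map_snd c])+
  moreover have "(s, s) \<in> W'" if s: "s \<in> topspace GUC" for s
  proof -
    have "\<phi> s \<in> topspace GUC" using funcset_mem[OF continuous_map_funspace[OF c] s] .
    then have "(\<phi> s, \<phi> s) \<in> W" using W(2) by blast
    then show ?thesis using s by (simp add: W'_def)
  qed
  ultimately have "\<forall>\<^sub>F u in nhds 0. \<forall>g. (GUC_map (g + u), GUC_map g) \<in> W'"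
    by (rule GUC_map_right_uniform)
  then show "\<forall>\<^sub>F u in nhds 0. \<forall>g. (GUC_act (g + u) y, GUC_act g y) \<in> E"
    by (rule eventually_mono) (use W(3) in \<open>auto simp: W'_def \<phi>g\<close>)
qed

section \<open>Equality of SUC(G) and UC(G)\<close>

text \<open>Every \<open>f\<close> in \<open>UC\<close> extends to \<open>GUC\<close> as evaluation
  at \<open>f\<close>, so \<open>GUC\<close> itself witnesses membership in
  \<open>SUC\<close>.\<close>

lemma SUC_space_GUC_imp_SUC_eq_UC:
  assumes "SUC_space GUC (GUC_act :: 'g::topological_group_add \<Rightarrow> _)"
  shows "SUC = (UC :: ('g \<Rightarrow> real) set)"
proof (rule equalityI[OF SUC_subset_UC subsetI])
  fix f :: "'g \<Rightarrow> real" assume f: "f \<in> UC"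
  show "f \<in> SUC"
  proof (rule SUC_anytype[OF assms dense_G_map_GUC continuous_map_GUC_eval[OF f]])
    show "f = (\<lambda>\<phi>. \<phi> f) \<circ> GUC_map" using f by (simp add: GUC_map_def fun_eq_iff)
  qed
qed

text \<open>The \<open>G\<close>-map through \<open>p\<close> is \<open>s \<mapsto> (f \<mapsto> s(h \<mapsto> p(f(h \<cdot>))))\<close>; the hypothesis makes the
  inner function a member of \<^term>\<open>UC\<close>, so that \<open>s\<close> may be applied to it.\<close>

lemma SUC_eq_UC_imp_point_universal:
  assumes eq: "SUC = (UC :: ('g::topological_group_add \<Rightarrow> real) set)"
  shows "point_universal GUC GUC_act (GUC_map (0::'g))"
  unfolding point_universal_GUC_iff
proof
  fix p :: "('g \<Rightarrow> real) \<Rightarrow> real" assume p: "p \<in> topspace GUC"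
  define M where "M f h = p (\<lambda>x. f (h + x))" for f h
  have M: "M f \<in> UC" if "f \<in> UC" for f
    unfolding M_def using SUC_coefficient_in_UC[OF _ p] that eq by blast
  \<comment> \<open>Since \<open>p\<close> is multiplicative and linear, \<open>M\<close> is a
    unital algebra endomorphism of \<open>UC\<close>; composing a point of \<open>GUC\<close> with
    it gives a point again.\<close>
  have M_add: "M (\<lambda>x. f x + k x) = (\<lambda>h. M f h + M k h)"
    and M_mult: "M (\<lambda>x. f x * k x) = (\<lambda>h. M f h * M k h)"
    if "f \<in> UC" "k \<in> UC" for f k
    using that by (simp_all add: M_def fun_eq_iff UC_translate GUC_add[OF p] GUC_mult[OF p])
  have M_cmult: "M (\<lambda>x. c * f x) = (\<lambda>h. c * M f h)" if "f \<in> UC" for f c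
    using that by (simp add: M_def fun_eq_iff UC_translate GUC_cmult[OF p])
  have M_const: "M (\<lambda>x. c) = (\<lambda>h. c)" for c by (simp add: M_def fun_eq_iff GUC_const[OF p])
  \<comment> \<open>\<open>M\<close> commutes with left translations, which makes
    \<open>\<phi>\<close> equivariant.\<close>
  have M_translate: "M (\<lambda>x. f (g + x)) = (\<lambda>h. M f (g + h))" for f g
    by (simp add: M_def fun_eq_iff add.assoc)
  define \<phi> where "\<phi> s = (\<lambda>f\<in>UC. s (M f))" for s :: "('g \<Rightarrow> real) \<Rightarrow> real"
  have \<phi>T: "\<phi> s \<in> topspace GUC" if s: "s \<in> topspace GUC" for s
    unfolding topspace_GUC[of "\<phi> s"]
    by (simp add: \<phi>_def UC_add UC_mult UC_cmult UC_const M_add M_mult M_cmult M_const M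
        GUC_add[OF s] GUC_mult[OF s] GUC_cmult[OF s] GUC_const[OF s])
  have "continuous_map GUC GUC \<phi>"
    unfolding continuous_map_into_GUC
    using \<phi>T by (simp add: \<phi>_def M continuous_map_GUC_eval)
  moreover have "\<phi> (GUC_act g s) = GUC_act g (\<phi> s)" for g s
    by (rule ext) (simp add: \<phi>_def GUC_act_def M UC_translate M_translate)
  moreover have "\<phi> (GUC_map 0) = p"
    by (rule GUC_eqI[OF \<phi>T[OF GUC_map_in] p]) (simp add: \<phi>_def GUC_map_def M, simp add: M_def)
  ultimately show "\<exists>\<phi>. G_map GUC GUC_act GUC GUC_act \<phi> \<and> \<phi> (GUC_map 0) = p"
    unfolding G_map_def by blast
qed

theorem corollary4p11:
  shows
    "((\<exists>m. right_top_semigroup_compactification GUC GUC_act m (GUC_map :: 'g::topological_group_add \<Rightarrow> _))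
        \<longleftrightarrow> point_universal GUC GUC_act (GUC_map (0::'g))) \<and>
     (point_universal GUC GUC_act (GUC_map (0::'g)) \<longleftrightarrow> SUC_space GUC (GUC_act :: 'g \<Rightarrow> _)) \<and>
     (SUC_space GUC (GUC_act :: 'g \<Rightarrow> _) \<longleftrightarrow> SUC = (UC :: ('g \<Rightarrow> real) set))"
  \<comment> \<open>The first two conditions are equivalent directly; the last three are linked by a
    cycle of implications.\<close>
  using semigroup_iff_point_universal[where 'a = 'g] point_universal_imp_SUC_space[where 'g = 'g]
    SUC_space_GUC_imp_SUC_eq_UC[where 'g = 'g] SUC_eq_UC_imp_point_universal[where 'g = 'g]
  by blast

end
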